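(* Let $G$ be a finite group, let $R$ be a commutative ring with $1\neq 0$, let $\eta:G\to\mathrm{Aut}(R)$ be an action of $G$ on $R$ by ring automorphisms, and let $f,f'\in Z^2_\eta(G,R^* )$. Then the crossed products $R_\eta^f*G$ and $R_\eta^{f'}*G$ are isometric if and only if the classes $[f]$ and $[f']$ belong to the same orbit of the action of $\mathrm{Aut}_\eta(G)$ on $H^2_\eta(G,R^* )$. Consequently, for a fixed action $\eta$, the Hamming isometry classes of the crossed products $R_\eta^f*G$, $f\in Z^2_\eta(G,R^* )$, are in one-to-one correspondence with the set of orbits $H^2_\eta(G,R^* )/\mathrm{Aut}_\eta(G)$.
   Context: Write $R^*$ for the group of units of $R$ and $g(r):=\eta(g)(r)$. $Z^2_\eta(G,R^* )$ is the group of 2-cocycles $f:G\times G\to R^*$ for the $G$-module $R^*$, i.e. $f(g,h)f(gh,k)=g(f(h,k))f(g,hk)$; coboundaries are the functions $(g,h)\mapsto r_g\,g(r_h)\,r_{gh}^{-1}$ for maps $g\mapsto r_g$ from $G$ to $R^*$; $H^2_\eta(G,R^* )$ is the quotient group, and $[f]$ is the class of $f$ (cocycles are not assumed normalized). The crossed product $R_\eta^f*G$ is the associative ring which is a free left $R$-module with basis $\{u_g\}_{g\in G}$ and multiplication determined by $(\beta u_g)(\gamma u_h)=\beta\, g(\gamma)\,f(g,h)\,u_{gh}$ for $\beta,\gamma\in R$; its identity is $f(e,e)^{-1}u_e$, and $R$ is identified with the subring $R\cdot 1$. The Hamming weight of $\sum_g\beta_gu_g$ is the number of $g$ with $\beta_g\neq0$.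 An isometry between two crossed products over $R$ is a bijective map which is both left $R$-linear and a ring homomorphism and which preserves the Hamming weights (taken with respect to the given graded bases). Two crossed products are isometric if such a map exists. $\mathrm{Aut}_\eta(G):=\{\psi\in\mathrm{Aut}(G)\mid \eta\circ\psi=\eta\}$. It acts (on the right) on $H^2_\eta(G,R^* )$ by $(\psi,[f])\mapsto[\psi(f)]$, where $\psi(f)(g,g'):=f(\psi(g),\psi(g'))$. *)

theory Defs
  imports "HOL-Algebra.Group_Action" "HOL-Algebra.Module" "HOL-Algebra.QuotRing"
begin

text \<open>Functions on carriers (automorphisms, cocycles, elements of a crossed product) are taken
  extensional, i.e. \<^const>\<open>undefined\<close> outside the carrier, as in \<^const>\<open>Bij\<close> and
  \<^const>\<open>auto\<close>, so that equality of functions is equality on the carrier.\<close>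

definition RingAut :: "('r, 'n) ring_scheme \<Rightarrow> ('r \<Rightarrow> 'r) monoid" where
  "RingAut R = BijGroup (carrier R) \<lparr>carrier := ring_iso R R \<inter> Bij (carrier R)\<rparr>"

definition cocycles ::
  "('g, 'm) monoid_scheme \<Rightarrow> ('r, 'n) ring_scheme \<Rightarrow> ('g \<Rightarrow> 'r \<Rightarrow> 'r) \<Rightarrow> ('g \<times> 'g \<Rightarrow> 'r) set" where
  "cocycles G R \<eta> = {f \<in> (carrier G \<times> carrier G) \<rightarrow>\<^sub>E Units R.
     \<forall>g\<in>carrier G. \<forall>h\<in>carrier G. \<forall>k\<in>carrier G.
       f (g, h) \<otimes>\<^bsub>R\<^esub> f (g \<otimes>\<^bsub>G\<^esub> h, k) = \<eta> g (f (h, k)) \<otimes>\<^bsub>R\<^esub> f (g, h \<otimes>\<^bsub>G\<^esub> k)}"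

definition Z2 ::
  "('g, 'm) monoid_scheme \<Rightarrow> ('r, 'n) ring_scheme \<Rightarrow> ('g \<Rightarrow> 'r \<Rightarrow> 'r) \<Rightarrow> ('g \<times> 'g \<Rightarrow> 'r) monoid" where
  "Z2 G R \<eta> = \<lparr>carrier = cocycles G R \<eta>,
     monoid.mult = (\<lambda>f f'. \<lambda>p \<in> carrier G \<times> carrier G. f p \<otimes>\<^bsub>R\<^esub> f' p),
     one = (\<lambda>p \<in> carrier G \<times> carrier G. \<one>\<^bsub>R\<^esub>)\<rparr>"

definition coboundary ::
  "('g, 'm) monoid_scheme \<Rightarrow> ('r, 'n) ring_scheme \<Rightarrow> ('g \<Rightarrow> 'r \<Rightarrow> 'r) \<Rightarrow> ('g \<Rightarrow> 'r) \<Rightarrow> 'g \<times> 'g \<Rightarrow> 'r" where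
  "coboundary G R \<eta> r = (\<lambda>(g, h) \<in> carrier G \<times> carrier G.
     r g \<otimes>\<^bsub>R\<^esub> \<eta> g (r h) \<otimes>\<^bsub>R\<^esub> inv\<^bsub>R\<^esub> (r (g \<otimes>\<^bsub>G\<^esub> h)))"

definition B2 ::
  "('g, 'm) monoid_scheme \<Rightarrow> ('r, 'n) ring_scheme \<Rightarrow> ('g \<Rightarrow> 'r \<Rightarrow> 'r) \<Rightarrow> ('g \<times> 'g \<Rightarrow> 'r) set" where
  "B2 G R \<eta> = coboundary G R \<eta> ` (carrier G \<rightarrow> Units R)"

definition H2 ::
  "('g, 'm) monoid_scheme \<Rightarrow> ('r, 'n) ring_scheme \<Rightarrow> ('g \<Rightarrow> 'r \<Rightarrow> 'r) \<Rightarrow> ('g \<times> 'g \<Rightarrow> 'r) set monoid" where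
  "H2 G R \<eta> = Z2 G R \<eta> Mod B2 G R \<eta>"

definition H2_class ::
  "('g, 'm) monoid_scheme \<Rightarrow> ('r, 'n) ring_scheme \<Rightarrow> ('g \<Rightarrow> 'r \<Rightarrow> 'r) \<Rightarrow> ('g \<times> 'g \<Rightarrow> 'r) \<Rightarrow> ('g \<times> 'g \<Rightarrow> 'r) set" where
  "H2_class G R \<eta> f = B2 G R \<eta> #>\<^bsub>Z2 G R \<eta>\<^esub> f"

definition AutFix :: "('g, 'm) monoid_scheme \<Rightarrow> ('g \<Rightarrow> 'r \<Rightarrow> 'r) \<Rightarrow> ('g \<Rightarrow> 'g) monoid" where
  "AutFix G \<eta> = AutoGroup G \<lparr>carrier := {\<psi> \<in> auto G. \<forall>g\<in>carrier G. \<eta> (\<psi> g) = \<eta> g}\<rparr>"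

definition twist ::
  "('g, 'm) monoid_scheme \<Rightarrow> ('g \<Rightarrow> 'g) \<Rightarrow> ('g \<times> 'g \<Rightarrow> 'r) \<Rightarrow> 'g \<times> 'g \<Rightarrow> 'r" where
  "twist G \<psi> f = (\<lambda>(g, h) \<in> carrier G \<times> carrier G. f (\<psi> g, \<psi> h))"

text \<open>The action on classes is defined through representatives; the union is over equal sets
  (lemma \<open>H2_act_class\<close> below). It is a right action (lemma \<open>twist_mult\<close>); the set
  \<^term>\<open>orbit K \<phi> x = {\<phi> g x | g. g \<in> carrier K}\<close> from the library does not depend on
  the side.\<close>

definition H2_act ::
  "('g, 'm) monoid_scheme \<Rightarrow> ('r, 'n) ring_scheme \<Rightarrow> ('g \<Rightarrow> 'r \<Rightarrow> 'r) \<Rightarrow> ('g \<Rightarrow> 'g)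
     \<Rightarrow> ('g \<times> 'g \<Rightarrow> 'r) set \<Rightarrow> ('g \<times> 'g \<Rightarrow> 'r) set" where
  "H2_act G R \<eta> \<psi> C = (\<Union>f\<in>C. H2_class G R \<eta> (twist G \<psi> f))"

definition H2_orbits ::
  "('g, 'm) monoid_scheme \<Rightarrow> ('r, 'n) ring_scheme \<Rightarrow> ('g \<Rightarrow> 'r \<Rightarrow> 'r) \<Rightarrow> ('g \<times> 'g \<Rightarrow> 'r) set set set" where
  "H2_orbits G R \<eta> = orbits (AutFix G \<eta>) (carrier (H2 G R \<eta>)) (H2_act G R \<eta>)"

text \<open>For finite \<open>G\<close>, the free left module with basis \<open>u\<^sub>g\<close> is realised as all functions
  \<open>carrier G \<rightarrow> carrier R\<close>, where \<open>x\<close> stands for the sum of the \<open>x g u\<^sub>g\<close>. The coefficient of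
  \<open>u\<^sub>k\<close> in a product collects the pairs \<open>(g, h)\<close> with \<open>g h = k\<close>, i.e. \<open>h = g\<^sup>-\<^sup>1 k\<close>.\<close>

definition crossed_product ::
  "('g, 'm) monoid_scheme \<Rightarrow> ('r, 'n) ring_scheme \<Rightarrow> ('g \<Rightarrow> 'r \<Rightarrow> 'r) \<Rightarrow> ('g \<times> 'g \<Rightarrow> 'r)
     \<Rightarrow> ('r, 'g \<Rightarrow> 'r) module" where
  "crossed_product G R \<eta> f =
    \<lparr>carrier = carrier G \<rightarrow>\<^sub>E carrier R,
     monoid.mult = (\<lambda>x y. \<lambda>k \<in> carrier G. \<Oplus>\<^bsub>R\<^esub>g \<in> carrier G.
        x g \<otimes>\<^bsub>R\<^esub> \<eta> g (y (inv\<^bsub>G\<^esub> g \<otimes>\<^bsub>G\<^esub> k)) \<otimes>\<^bsub>R\<^esub> f (g, inv\<^bsub>G\<^esub> g \<otimes>\<^bsub>G\<^esub> k)),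
     one = (\<lambda>k \<in> carrier G. if k = \<one>\<^bsub>G\<^esub> then inv\<^bsub>R\<^esub> (f (\<one>\<^bsub>G\<^esub>, \<one>\<^bsub>G\<^esub>)) else \<zero>\<^bsub>R\<^esub>),
     zero = (\<lambda>k \<in> carrier G. \<zero>\<^bsub>R\<^esub>),
     add = (\<lambda>x y. \<lambda>k \<in> carrier G. x k \<oplus>\<^bsub>R\<^esub> y k),
     module.smult = (\<lambda>a x. \<lambda>k \<in> carrier G. a \<otimes>\<^bsub>R\<^esub> x k)\<rparr>"

definition hamming_weight ::
  "('g, 'm) monoid_scheme \<Rightarrow> ('r, 'n) ring_scheme \<Rightarrow> ('g \<Rightarrow> 'r) \<Rightarrow> nat" where
  "hamming_weight G R x = card {g \<in> carrier G. x g \<noteq> \<zero>\<^bsub>R\<^esub>}"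

definition isometry ::
  "('g, 'm) monoid_scheme \<Rightarrow> ('r, 'n) ring_scheme \<Rightarrow> ('r, 'g \<Rightarrow> 'r) module
     \<Rightarrow> ('r, 'g \<Rightarrow> 'r) module \<Rightarrow> (('g \<Rightarrow> 'r) \<Rightarrow> 'g \<Rightarrow> 'r) \<Rightarrow> bool" where
  "isometry G R A B \<phi> \<longleftrightarrow>
     bij_betw \<phi> (carrier A) (carrier B) \<and>
     \<phi> \<in> ring_hom A B \<and>
     (\<forall>a\<in>carrier R. \<forall>x\<in>carrier A. \<phi> (a \<odot>\<^bsub>A\<^esub> x) = a \<odot>\<^bsub>B\<^esub> \<phi> x) \<and>
     (\<forall>x\<in>carrier A. hamming_weight G R (\<phi> x) = hamming_weight G R x)"

definition isometric ::
  "('g, 'm) monoid_scheme \<Rightarrow> ('r, 'n) ring_scheme \<Rightarrow> ('r, 'g \<Rightarrow> 'r) module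
     \<Rightarrow> ('r, 'g \<Rightarrow> 'r) module \<Rightarrow> bool" where
  "isometric G R A B \<longleftrightarrow> (\<exists>\<phi>. isometry G R A B \<phi>)"

definition crossed_products ::
  "('g, 'm) monoid_scheme \<Rightarrow> ('r, 'n) ring_scheme \<Rightarrow> ('g \<Rightarrow> 'r \<Rightarrow> 'r) \<Rightarrow> ('r, 'g \<Rightarrow> 'r) module set" where
  "crossed_products G R \<eta> = crossed_product G R \<eta> ` cocycles G R \<eta>"

definition isometry_rel ::
  "('g, 'm) monoid_scheme \<Rightarrow> ('r, 'n) ring_scheme \<Rightarrow> ('g \<Rightarrow> 'r \<Rightarrow> 'r) \<Rightarrow> ('r, 'g \<Rightarrow> 'r) module rel" where
  "isometry_rel G R \<eta> =
     {(A, B) \<in> crossed_products G R \<eta> \<times> crossed_products G R \<eta>. isometric G R A B}"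

locale ring_action = G: group G + R: cring R
  for G :: "('g, 'm) monoid_scheme" and R :: "('r, 'n) ring_scheme" +
  fixes \<eta> :: "'g \<Rightarrow> 'r \<Rightarrow> 'r"
  assumes action: "\<eta> \<in> hom G (RingAut R)"
begin

lemma act_aut: "g \<in> carrier G \<Longrightarrow> \<eta> g \<in> ring_hom R R"
  and act_ext: "g \<in> carrier G \<Longrightarrow> \<eta> g \<in> extensional (carrier R)"
  and act_bij: "g \<in> carrier G \<Longrightarrow> bij_betw (\<eta> g) (carrier R) (carrier R)"
  using action by (auto simp: hom_def RingAut_def ring_iso_def Bij_def Pi_iff)

lemma act_closed [simp]: "g \<in> carrier G \<Longrightarrow> a \<in> carrier R \<Longrightarrow> \<eta> g a \<in> carrier R"
  and act_mult: "g \<in> carrier G \<Longrightarrow> a \<in> carrier R \<Longrightarrow> b \<in> carrier R \<Longrightarrow>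
    \<eta> g (a \<otimes>\<^bsub>R\<^esub> b) = \<eta> g a \<otimes>\<^bsub>R\<^esub> \<eta> g b"
  and act_add: "g \<in> carrier G \<Longrightarrow> a \<in> carrier R \<Longrightarrow> b \<in> carrier R \<Longrightarrow>
    \<eta> g (a \<oplus>\<^bsub>R\<^esub> b) = \<eta> g a \<oplus>\<^bsub>R\<^esub> \<eta> g b"
  and act_one [simp]: "g \<in> carrier G \<Longrightarrow> \<eta> g \<one>\<^bsub>R\<^esub> = \<one>\<^bsub>R\<^esub>"
  using act_aut[of g] by (auto simp: ring_hom_def)

lemma act_zero [simp]: "g \<in> carrier G \<Longrightarrow> \<eta> g \<zero>\<^bsub>R\<^esub> = \<zero>\<^bsub>R\<^esub>"
  by (rule ring_hom_zero[OF act_aut]) (auto intro: R.ring_axioms)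

lemma act_act: "g \<in> carrier G \<Longrightarrow> h \<in> carrier G \<Longrightarrow> a \<in> carrier R \<Longrightarrow>
    \<eta> (g \<otimes>\<^bsub>G\<^esub> h) a = \<eta> g (\<eta> h a)"
  using action by (auto simp: hom_def RingAut_def BijGroup_def compose_def Pi_iff)

lemma act_id [simp]: assumes "a \<in> carrier R" shows "\<eta> \<one>\<^bsub>G\<^esub> a = a"
proof -
  have "\<eta> \<one>\<^bsub>G\<^esub> (\<eta> \<one>\<^bsub>G\<^esub> a) = \<eta> \<one>\<^bsub>G\<^esub> a"
    using act_act[of "\<one>\<^bsub>G\<^esub>" "\<one>\<^bsub>G\<^esub>" a] assms by simp
  then show ?thesis
    using act_bij[of "\<one>\<^bsub>G\<^esub>"] assms by (auto simp: bij_betw_def inj_on_def)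
qed

lemma act_Units [simp]:
  assumes "g \<in> carrier G" "u \<in> Units R" shows "\<eta> g u \<in> Units R"
proof -
  have u: "u \<in> carrier R" using assms(2) by (rule R.Units_closed)
  have i: "inv\<^bsub>R\<^esub> u \<in> carrier R" using assms(2) by simp
  have "\<eta> g u \<otimes>\<^bsub>R\<^esub> \<eta> g (inv\<^bsub>R\<^esub> u) = \<one>\<^bsub>R\<^esub>"
    using act_mult[OF assms(1) u i] assms by simp
  then show ?thesis
    using assms(1) u i R.m_comm[of "\<eta> g u" "\<eta> g (inv\<^bsub>R\<^esub> u)"] by (auto simp: Units_def)
qed

lemma cocycles_Units: "f \<in> cocycles G R \<eta> \<Longrightarrow> g \<in> carrier G \<Longrightarrow> h \<in> carrier G \<Longrightarrow> f (g, h) \<in> Units R"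
  and cocycles_ext: "f \<in> cocycles G R \<eta> \<Longrightarrow> f \<in> extensional (carrier G \<times> carrier G)"
  and cocycle: "f \<in> cocycles G R \<eta> \<Longrightarrow> g \<in> carrier G \<Longrightarrow> h \<in> carrier G \<Longrightarrow> k \<in> carrier G \<Longrightarrow>
    f (g, h) \<otimes>\<^bsub>R\<^esub> f (g \<otimes>\<^bsub>G\<^esub> h, k) = \<eta> g (f (h, k)) \<otimes>\<^bsub>R\<^esub> f (g, h \<otimes>\<^bsub>G\<^esub> k)"
  unfolding cocycles_def by (auto simp: PiE_def)

lemma cocycles_closed: "f \<in> cocycles G R \<eta> \<Longrightarrow> g \<in> carrier G \<Longrightarrow> h \<in> carrier G \<Longrightarrow> f (g, h) \<in> carrier R"
  using cocycles_Units R.Units_closed by blast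

lemma cocyclesI:
  assumes "\<And>g h. g \<in> carrier G \<Longrightarrow> h \<in> carrier G \<Longrightarrow> f (g, h) \<in> Units R"
    "f \<in> extensional (carrier G \<times> carrier G)"
    "\<And>g h k. g \<in> carrier G \<Longrightarrow> h \<in> carrier G \<Longrightarrow> k \<in> carrier G \<Longrightarrow>
      f (g, h) \<otimes>\<^bsub>R\<^esub> f (g \<otimes>\<^bsub>G\<^esub> h, k) = \<eta> g (f (h, k)) \<otimes>\<^bsub>R\<^esub> f (g, h \<otimes>\<^bsub>G\<^esub> k)"
  shows "f \<in> cocycles G R \<eta>"
  using assms unfolding cocycles_def by (auto simp: PiE_def)

lemma Z2_mult_closed:
  assumes f: "f \<in> cocycles G R \<eta>" and f': "f' \<in> cocycles G R \<eta>"
  shows "(\<lambda>p \<in> carrier G \<times> carrier G. f p \<otimes>\<^bsub>R\<^esub> f' p) \<in> cocycles G R \<eta>"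
proof (rule cocyclesI)
  fix g h k assume ghk: "g \<in> carrier G" "h \<in> carrier G" "k \<in> carrier G"
  have "(f (g, h) \<otimes>\<^bsub>R\<^esub> f' (g, h)) \<otimes>\<^bsub>R\<^esub> (f (g \<otimes>\<^bsub>G\<^esub> h, k) \<otimes>\<^bsub>R\<^esub> f' (g \<otimes>\<^bsub>G\<^esub> h, k)) =
    (f (g, h) \<otimes>\<^bsub>R\<^esub> f (g \<otimes>\<^bsub>G\<^esub> h, k)) \<otimes>\<^bsub>R\<^esub> (f' (g, h) \<otimes>\<^bsub>R\<^esub> f' (g \<otimes>\<^bsub>G\<^esub> h, k))"
    using ghk cocycles_closed[OF f] cocycles_closed[OF f'] by (simp add: R.m_ac)
  also have "\<dots> = (\<eta> g (f (h, k)) \<otimes>\<^bsub>R\<^esub> f (g, h \<otimes>\<^bsub>G\<^esub> k)) \<otimes>\<^bsub>R\<^esub> (\<eta> g (f' (h, k)) \<otimes>\<^bsub>R\<^esub> f' (g, h \<otimes>\<^bsub>G\<^esub> k))"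
    using ghk cocycle[OF f] cocycle[OF f'] by simp
  also have "\<dots> = \<eta> g (f (h, k) \<otimes>\<^bsub>R\<^esub> f' (h, k)) \<otimes>\<^bsub>R\<^esub> (f (g, h \<otimes>\<^bsub>G\<^esub> k) \<otimes>\<^bsub>R\<^esub> f' (g, h \<otimes>\<^bsub>G\<^esub> k))"
    using ghk cocycles_closed[OF f] cocycles_closed[OF f'] by (simp add: R.m_ac act_mult)
  finally show "(\<lambda>p \<in> carrier G \<times> carrier G. f p \<otimes>\<^bsub>R\<^esub> f' p) (g, h) \<otimes>\<^bsub>R\<^esub>
      (\<lambda>p \<in> carrier G \<times> carrier G. f p \<otimes>\<^bsub>R\<^esub> f' p) (g \<otimes>\<^bsub>G\<^esub> h, k) =
    \<eta> g ((\<lambda>p \<in> carrier G \<times> carrier G. f p \<otimes>\<^bsub>R\<^esub> f' p) (h, k)) \<otimes>\<^bsub>R\<^esub>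
      (\<lambda>p \<in> carrier G \<times> carrier G. f p \<otimes>\<^bsub>R\<^esub> f' p) (g, h \<otimes>\<^bsub>G\<^esub> k)"
    using ghk by simp
qed (use cocycles_Units[OF f] cocycles_Units[OF f'] in auto)

lemma act_inv:
  assumes "g \<in> carrier G" "u \<in> Units R" shows "\<eta> g (inv\<^bsub>R\<^esub> u) = inv\<^bsub>R\<^esub> (\<eta> g u)"
proof -
  have u: "u \<in> carrier R" "inv\<^bsub>R\<^esub> u \<in> carrier R"
    using assms(2) by (simp_all add: R.Units_closed)
  have "\<eta> g u \<otimes>\<^bsub>R\<^esub> \<eta> g (inv\<^bsub>R\<^esub> u) = \<one>\<^bsub>R\<^esub>"
    using act_mult[OF assms(1) u] assms by simp
  then show ?thesis
    using R.comm_inv_char[of "\<eta> g u" "\<eta> g (inv\<^bsub>R\<^esub> u)"] assms(1) u by simp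
qed

lemma inv_mult:
  assumes "a \<in> Units R" "b \<in> Units R"
  shows "inv\<^bsub>R\<^esub> a \<otimes>\<^bsub>R\<^esub> inv\<^bsub>R\<^esub> b = inv\<^bsub>R\<^esub> (a \<otimes>\<^bsub>R\<^esub> b)"
proof -
  have c: "a \<in> carrier R" "b \<in> carrier R" "inv\<^bsub>R\<^esub> a \<in> carrier R" "inv\<^bsub>R\<^esub> b \<in> carrier R"
    using assms by (simp_all add: R.Units_closed)
  have "(a \<otimes>\<^bsub>R\<^esub> b) \<otimes>\<^bsub>R\<^esub> (inv\<^bsub>R\<^esub> a \<otimes>\<^bsub>R\<^esub> inv\<^bsub>R\<^esub> b) =
    (a \<otimes>\<^bsub>R\<^esub> inv\<^bsub>R\<^esub> a) \<otimes>\<^bsub>R\<^esub> (b \<otimes>\<^bsub>R\<^esub> inv\<^bsub>R\<^esub> b)"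
    using c by (simp add: R.m_ac del: R.Units_r_inv R.Units_l_inv)
  also have "\<dots> = \<one>\<^bsub>R\<^esub>" using assms by simp
  finally show ?thesis
    using R.comm_inv_char[of "a \<otimes>\<^bsub>R\<^esub> b" "inv\<^bsub>R\<^esub> a \<otimes>\<^bsub>R\<^esub> inv\<^bsub>R\<^esub> b"] c by simp
qed

lemma Z2_inv_closed:
  assumes f: "f \<in> cocycles G R \<eta>"
  shows "(\<lambda>p \<in> carrier G \<times> carrier G. inv\<^bsub>R\<^esub> (f p)) \<in> cocycles G R \<eta>"
proof (rule cocyclesI)
  fix g h k assume ghk: "g \<in> carrier G" "h \<in> carrier G" "k \<in> carrier G"
  show "(\<lambda>p \<in> carrier G \<times> carrier G. inv\<^bsub>R\<^esub> (f p)) (g, h) \<otimes>\<^bsub>R\<^esub>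
      (\<lambda>p \<in> carrier G \<times> carrier G. inv\<^bsub>R\<^esub> (f p)) (g \<otimes>\<^bsub>G\<^esub> h, k) =
    \<eta> g ((\<lambda>p \<in> carrier G \<times> carrier G. inv\<^bsub>R\<^esub> (f p)) (h, k)) \<otimes>\<^bsub>R\<^esub>
      (\<lambda>p \<in> carrier G \<times> carrier G. inv\<^bsub>R\<^esub> (f p)) (g, h \<otimes>\<^bsub>G\<^esub> k)"
    using ghk cocycles_Units[OF f] cocycle[OF f] by (simp add: act_inv inv_mult)
qed (use cocycles_Units[OF f] in auto)

lemma Z2_one_closed: "(\<lambda>p \<in> carrier G \<times> carrier G. \<one>\<^bsub>R\<^esub>) \<in> cocycles G R \<eta>"
  by (rule cocyclesI) auto

lemma comm_group_Z2: "comm_group (Z2 G R \<eta>)"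
proof (rule comm_groupI)
  fix x assume x: "x \<in> carrier (Z2 G R \<eta>)"
  then have "x \<in> cocycles G R \<eta>" by (simp add: Z2_def)
  then show "\<exists>y\<in>carrier (Z2 G R \<eta>). y \<otimes>\<^bsub>Z2 G R \<eta>\<^esub> x = \<one>\<^bsub>Z2 G R \<eta>\<^esub>"
    by (intro bexI[of _ "\<lambda>p \<in> carrier G \<times> carrier G. inv\<^bsub>R\<^esub> (x p)"])
       (auto simp: Z2_def fun_eq_iff restrict_def cocycles_Units Z2_inv_closed[unfolded restrict_def])
  show "\<one>\<^bsub>Z2 G R \<eta>\<^esub> \<otimes>\<^bsub>Z2 G R \<eta>\<^esub> x = x"
    using \<open>x \<in> cocycles G R \<eta>\<close> cocycles_ext[of x] cocycles_closed[of x]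
    by (auto simp: Z2_def fun_eq_iff restrict_def extensional_def)
qed (auto simp: Z2_def Z2_mult_closed[unfolded restrict_def] Z2_one_closed[unfolded restrict_def]
  fun_eq_iff restrict_def cocycles_closed R.m_ac)

lemma coboundary_cocycle:
  assumes r: "r \<in> carrier G \<rightarrow> Units R"
  shows "coboundary G R \<eta> r \<in> cocycles G R \<eta>"
proof (rule cocyclesI)
  have U: "r g \<in> Units R" if "g \<in> carrier G" for g using r that by auto
  have C: "r g \<in> carrier R" if "g \<in> carrier G" for g using U that by auto
  fix g h k assume ghk: "g \<in> carrier G" "h \<in> carrier G" "k \<in> carrier G"
  define a b c where "a = r g" "b = \<eta> g (r h)" "c = \<eta> g (\<eta> h (r k))"
  define p q s where "p = r (g \<otimes>\<^bsub>G\<^esub> h)" "q = \<eta> g (r (h \<otimes>\<^bsub>G\<^esub> k))" "s = r (g \<otimes>\<^bsub>G\<^esub> (h \<otimes>\<^bsub>G\<^esub> k))"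
  have mem: "a \<in> carrier R" "b \<in> carrier R" "c \<in> carrier R" "p \<in> Units R" "q \<in> Units R" "s \<in> Units R"
    using ghk by (auto simp: a_b_c_def p_q_s_def C U)
  have "coboundary G R \<eta> r (g, h) \<otimes>\<^bsub>R\<^esub> coboundary G R \<eta> r (g \<otimes>\<^bsub>G\<^esub> h, k) =
     (a \<otimes>\<^bsub>R\<^esub> b \<otimes>\<^bsub>R\<^esub> inv\<^bsub>R\<^esub> p) \<otimes>\<^bsub>R\<^esub> (p \<otimes>\<^bsub>R\<^esub> c \<otimes>\<^bsub>R\<^esub> inv\<^bsub>R\<^esub> s)"
    using ghk by (simp add: coboundary_def a_b_c_def p_q_s_def act_act C G.m_assoc)
  also have "\<dots> = (a \<otimes>\<^bsub>R\<^esub> b) \<otimes>\<^bsub>R\<^esub> (c \<otimes>\<^bsub>R\<^esub> inv\<^bsub>R\<^esub> s) \<otimes>\<^bsub>R\<^esub> (p \<otimes>\<^bsub>R\<^esub> inv\<^bsub>R\<^esub> p)"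
    using mem R.Units_inv_closed[OF mem(4)] R.Units_inv_closed[OF mem(6)] R.Units_closed[OF mem(4)]
    by (simp add: R.m_ac del: R.Units_r_inv R.Units_l_inv)
  also have "\<dots> = (a \<otimes>\<^bsub>R\<^esub> b) \<otimes>\<^bsub>R\<^esub> (c \<otimes>\<^bsub>R\<^esub> inv\<^bsub>R\<^esub> s) \<otimes>\<^bsub>R\<^esub> (q \<otimes>\<^bsub>R\<^esub> inv\<^bsub>R\<^esub> q)"
    using mem by simp
  also have "\<dots> = (b \<otimes>\<^bsub>R\<^esub> c \<otimes>\<^bsub>R\<^esub> inv\<^bsub>R\<^esub> q) \<otimes>\<^bsub>R\<^esub> (a \<otimes>\<^bsub>R\<^esub> q \<otimes>\<^bsub>R\<^esub> inv\<^bsub>R\<^esub> s)"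
    using mem R.Units_inv_closed[OF mem(5)] R.Units_inv_closed[OF mem(6)] R.Units_closed[OF mem(5)]
    by (simp add: R.m_ac del: R.Units_r_inv R.Units_l_inv)
  also have "\<dots> = \<eta> g (coboundary G R \<eta> r (h, k)) \<otimes>\<^bsub>R\<^esub> coboundary G R \<eta> r (g, h \<otimes>\<^bsub>G\<^esub> k)"
    using ghk by (simp add: coboundary_def a_b_c_def p_q_s_def act_mult act_inv C U G.m_assoc)
  finally show "coboundary G R \<eta> r (g, h) \<otimes>\<^bsub>R\<^esub> coboundary G R \<eta> r (g \<otimes>\<^bsub>G\<^esub> h, k) =
    \<eta> g (coboundary G R \<eta> r (h, k)) \<otimes>\<^bsub>R\<^esub> coboundary G R \<eta> r (g, h \<otimes>\<^bsub>G\<^esub> k)" .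
next
  show "coboundary G R \<eta> r \<in> extensional (carrier G \<times> carrier G)"
    by (simp add: coboundary_def)
next
  fix g h assume "g \<in> carrier G" "h \<in> carrier G"
  then show "coboundary G R \<eta> r (g, h) \<in> Units R"
    using r by (auto simp: coboundary_def Pi_iff)
qed

interpretation Z2: comm_group "Z2 G R \<eta>"
  by (rule comm_group_Z2)

lemma Z2_simps:
  "carrier (Z2 G R \<eta>) = cocycles G R \<eta>"
  "f \<otimes>\<^bsub>Z2 G R \<eta>\<^esub> f' = (\<lambda>p \<in> carrier G \<times> carrier G. f p \<otimes>\<^bsub>R\<^esub> f' p)"
  "\<one>\<^bsub>Z2 G R \<eta>\<^esub> = (\<lambda>p \<in> carrier G \<times> carrier G. \<one>\<^bsub>R\<^esub>)"
  by (simp_all add: Z2_def)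

lemma coboundary_mult:
  assumes r: "r \<in> carrier G \<rightarrow> Units R" and s: "s \<in> carrier G \<rightarrow> Units R"
  shows "coboundary G R \<eta> r \<otimes>\<^bsub>Z2 G R \<eta>\<^esub> coboundary G R \<eta> s =
    coboundary G R \<eta> (\<lambda>g. r g \<otimes>\<^bsub>R\<^esub> s g)"
proof
  fix p :: "'g \<times> 'g"
  obtain g h where p: "p = (g, h)" by (cases p)
  show "(coboundary G R \<eta> r \<otimes>\<^bsub>Z2 G R \<eta>\<^esub> coboundary G R \<eta> s) p =
    coboundary G R \<eta> (\<lambda>g. r g \<otimes>\<^bsub>R\<^esub> s g) p"
  proof (cases "g \<in> carrier G \<and> h \<in> carrier G")
    case True
    then have U: "r g \<in> Units R" "r h \<in> Units R" "r (g \<otimes>\<^bsub>G\<^esub> h) \<in> Units R"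
      "s g \<in> Units R" "s h \<in> Units R" "s (g \<otimes>\<^bsub>G\<^esub> h) \<in> Units R"
      using r s by auto
    then show ?thesis
      using True U[THEN R.Units_closed] U[THEN R.Units_inv_closed]
      by (simp add: p Z2_simps coboundary_def act_mult inv_mult[symmetric] R.m_ac)
  qed (auto simp: p Z2_simps coboundary_def)
qed

lemma subgroup_B2: "subgroup (B2 G R \<eta>) (Z2 G R \<eta>)"
proof (rule Z2.subgroupI)
  show "B2 G R \<eta> \<subseteq> carrier (Z2 G R \<eta>)"
    using coboundary_cocycle by (auto simp: B2_def Z2_simps)
  show "B2 G R \<eta> \<noteq> {}"
    using R.Units_one_closed by (auto simp: B2_def Pi_def)
next
  fix b assume "b \<in> B2 G R \<eta>"
  then obtain r where r: "r \<in> carrier G \<rightarrow> Units R" "b = coboundary G R \<eta> r"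
    by (auto simp: B2_def)
  have s: "(\<lambda>g. inv\<^bsub>R\<^esub> (r g)) \<in> carrier G \<rightarrow> Units R" using r(1) by auto
  have U: "r g \<in> Units R" if "g \<in> carrier G" for g using r(1) that by auto
  have "coboundary G R \<eta> (\<lambda>g. inv\<^bsub>R\<^esub> (r g)) \<otimes>\<^bsub>Z2 G R \<eta>\<^esub> b = \<one>\<^bsub>Z2 G R \<eta>\<^esub>"
    unfolding r(2) coboundary_mult[OF s r(1)]
    by (auto simp: coboundary_def Z2_simps restrict_def fun_eq_iff U)
  then have "inv\<^bsub>Z2 G R \<eta>\<^esub> b = coboundary G R \<eta> (\<lambda>g. inv\<^bsub>R\<^esub> (r g))"
    using Z2.inv_equality coboundary_cocycle[OF s] coboundary_cocycle[OF r(1)] r(2)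
    by (simp add: Z2_simps(1))
  then show "inv\<^bsub>Z2 G R \<eta>\<^esub> b \<in> B2 G R \<eta>" using s by (auto simp: B2_def)
next
  fix b c assume "b \<in> B2 G R \<eta>" "c \<in> B2 G R \<eta>"
  then obtain r s where r: "r \<in> carrier G \<rightarrow> Units R" "b = coboundary G R \<eta> r"
    and s: "s \<in> carrier G \<rightarrow> Units R" "c = coboundary G R \<eta> s"
    by (auto simp: B2_def)
  have "(\<lambda>g. r g \<otimes>\<^bsub>R\<^esub> s g) \<in> carrier G \<rightarrow> Units R" using r s by auto
  then show "b \<otimes>\<^bsub>Z2 G R \<eta>\<^esub> c \<in> B2 G R \<eta>"
    unfolding r s coboundary_mult[OF r(1) s(1)] by (auto simp: B2_def)
qed

lemma comm_group_H2: "comm_group (H2 G R \<eta>)"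
  unfolding H2_def by (rule Z2.abelian_FactGroup[OF subgroup_B2])

lemma carrier_H2: "carrier (H2 G R \<eta>) = H2_class G R \<eta> ` cocycles G R \<eta>"
  by (auto simp: H2_def H2_class_def FactGroup_def RCOSETS_def Z2_simps)

lemma twist_closed:
  assumes \<psi>: "\<psi> \<in> carrier (AutFix G \<eta>)" and f: "f \<in> cocycles G R \<eta>"
  shows "twist G \<psi> f \<in> cocycles G R \<eta>"
proof (rule cocyclesI)
  have c: "\<psi> g \<in> carrier G" "\<eta> (\<psi> g) = \<eta> g" if "g \<in> carrier G" for g
    using \<psi> that by (auto simp: AutFix_def auto_def hom_def)
  have m: "\<psi> (g \<otimes>\<^bsub>G\<^esub> h) = \<psi> g \<otimes>\<^bsub>G\<^esub> \<psi> h" if "g \<in> carrier G" "h \<in> carrier G" for g h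
    using \<psi> that by (auto simp: AutFix_def auto_def hom_def)
  show "twist G \<psi> f (g, h) \<in> Units R" if "g \<in> carrier G" "h \<in> carrier G" for g h
    using that by (simp add: twist_def c cocycles_Units[OF f])
  show "twist G \<psi> f \<in> extensional (carrier G \<times> carrier G)"
    by (simp add: twist_def)
  show "twist G \<psi> f (g, h) \<otimes>\<^bsub>R\<^esub> twist G \<psi> f (g \<otimes>\<^bsub>G\<^esub> h, k) =
    \<eta> g (twist G \<psi> f (h, k)) \<otimes>\<^bsub>R\<^esub> twist G \<psi> f (g, h \<otimes>\<^bsub>G\<^esub> k)"
    if "g \<in> carrier G" "h \<in> carrier G" "k \<in> carrier G" for g h k
    using that cocycle[OF f, of "\<psi> g" "\<psi> h" "\<psi> k"] by (simp add: twist_def c m)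
qed

lemma twist_coboundary:
  assumes \<psi>: "\<psi> \<in> carrier (AutFix G \<eta>)" and b: "b \<in> B2 G R \<eta>"
  shows "twist G \<psi> b \<in> B2 G R \<eta>"
proof -
  have c: "\<psi> g \<in> carrier G" "\<eta> (\<psi> g) = \<eta> g" if "g \<in> carrier G" for g
    using \<psi> that by (auto simp: AutFix_def auto_def hom_def)
  have m: "\<psi> (g \<otimes>\<^bsub>G\<^esub> h) = \<psi> g \<otimes>\<^bsub>G\<^esub> \<psi> h" if "g \<in> carrier G" "h \<in> carrier G" for g h
    using \<psi> that by (auto simp: AutFix_def auto_def hom_def)
  obtain r where r: "r \<in> carrier G \<rightarrow> Units R" "b = coboundary G R \<eta> r"
    using b by (auto simp: B2_def)
  have "twist G \<psi> b = coboundary G R \<eta> (\<lambda>g. r (\<psi> g))"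
    by (auto simp: r(2) twist_def coboundary_def restrict_def fun_eq_iff c m)
  moreover have "(\<lambda>g. r (\<psi> g)) \<in> carrier G \<rightarrow> Units R" using r(1) c by auto
  ultimately show ?thesis by (auto simp: B2_def)
qed

lemma H2_act_class:
  assumes \<psi>: "\<psi> \<in> carrier (AutFix G \<eta>)" and f: "f \<in> cocycles G R \<eta>"
  shows "H2_act G R \<eta> \<psi> (H2_class G R \<eta> f) = H2_class G R \<eta> (twist G \<psi> f)"
proof -
  have "H2_class G R \<eta> (twist G \<psi> f') = H2_class G R \<eta> (twist G \<psi> f)"
    if f': "f' \<in> H2_class G R \<eta> f" for f'
  proof -
    obtain b where b: "b \<in> B2 G R \<eta>" "f' = b \<otimes>\<^bsub>Z2 G R \<eta>\<^esub> f"
      using f' by (auto simp: H2_class_def r_coset_def)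
    have c: "\<psi> g \<in> carrier G" if "g \<in> carrier G" for g
      using \<psi> that by (auto simp: AutFix_def auto_def hom_def)
    have "twist G \<psi> f' = twist G \<psi> b \<otimes>\<^bsub>Z2 G R \<eta>\<^esub> twist G \<psi> f"
      by (auto simp: b(2) twist_def Z2_simps restrict_def fun_eq_iff c)
    then have "twist G \<psi> f' \<in> H2_class G R \<eta> (twist G \<psi> f)"
      using twist_coboundary[OF \<psi> b(1)] by (auto simp: H2_class_def r_coset_def)
    then show ?thesis
      using Z2.repr_independence subgroup_B2 twist_closed[OF \<psi> f]
      unfolding H2_class_def Z2_simps(1)[symmetric] by metis
  qed
  moreover have "f \<in> H2_class G R \<eta> f"
    unfolding H2_class_def
    using Z2.rcos_self[OF _ subgroup_B2] f by (simp add: Z2_simps(1))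
  ultimately show ?thesis unfolding H2_act_def by blast
qed

lemma group_AutFix: "group (AutFix G \<eta>)"
proof -
  interpret A: group "AutoGroup G" by (rule G.AutoGroup)
  have mult: "\<psi> \<otimes>\<^bsub>AutoGroup G\<^esub> \<phi> = compose (carrier G) \<psi> \<phi>" if "\<psi> \<in> auto G" "\<phi> \<in> auto G" for \<psi> \<phi>
    using that by (simp add: AutoGroup_def BijGroup_def auto_def)
  have one: "\<one>\<^bsub>AutoGroup G\<^esub> = (\<lambda>x\<in>carrier G. x)" by (simp add: AutoGroup_def BijGroup_def)
  have car: "carrier (AutoGroup G) = auto G" by (simp add: AutoGroup_def)
  have "subgroup {\<psi> \<in> auto G. \<forall>g\<in>carrier G. \<eta> (\<psi> g) = \<eta> g} (AutoGroup G)"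
  proof (rule A.subgroupI)
    show "{\<psi> \<in> auto G. \<forall>g\<in>carrier G. \<eta> (\<psi> g) = \<eta> g} \<noteq> {}"
      using G.id_in_auto by fastforce
  next
    fix \<psi> assume "\<psi> \<in> {\<psi> \<in> auto G. \<forall>g\<in>carrier G. \<eta> (\<psi> g) = \<eta> g}"
    then have \<psi>: "\<psi> \<in> auto G" "\<And>g. g \<in> carrier G \<Longrightarrow> \<eta> (\<psi> g) = \<eta> g" by auto
    let ?i = "inv\<^bsub>AutoGroup G\<^esub> \<psi>"
    have i: "?i \<in> auto G" using A.inv_closed[of \<psi>] \<psi>(1) by (simp add: car)
    have "\<psi> (?i g) = g" "?i g \<in> carrier G" if "g \<in> carrier G" for g
    proof -
      show "?i g \<in> carrier G" using i that by (auto simp: auto_def hom_def)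
      have "compose (carrier G) \<psi> ?i = (\<lambda>x\<in>carrier G. x)"
        using A.r_inv[of \<psi>] mult[OF \<psi>(1) i] \<psi>(1) by (simp add: car one)
      from fun_cong[OF this, of g] show "\<psi> (?i g) = g"
        using that by (simp add: compose_def)
    qed
    then have "\<eta> (?i g) = \<eta> g" if "g \<in> carrier G" for g
      using \<psi>(2)[of "?i g"] that by simp
    then show "?i \<in> {\<psi> \<in> auto G. \<forall>g\<in>carrier G. \<eta> (\<psi> g) = \<eta> g}" using i by blast
  next
    fix \<psi> \<phi> assume "\<psi> \<in> {\<psi> \<in> auto G. \<forall>g\<in>carrier G. \<eta> (\<psi> g) = \<eta> g}"
      "\<phi> \<in> {\<psi> \<in> auto G. \<forall>g\<in>carrier G. \<eta> (\<psi> g) = \<eta> g}"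
    then have *: "\<psi> \<in> auto G" "\<phi> \<in> auto G" "\<And>g. g \<in> carrier G \<Longrightarrow> \<eta> (\<psi> g) = \<eta> g"
      "\<And>g. g \<in> carrier G \<Longrightarrow> \<eta> (\<phi> g) = \<eta> g" by auto
    have "\<psi> \<otimes>\<^bsub>AutoGroup G\<^esub> \<phi> \<in> auto G" using A.m_closed[of \<psi> \<phi>] * by (simp add: car)
    moreover have "\<phi> g \<in> carrier G" if "g \<in> carrier G" for g
      using *(2) that by (auto simp: auto_def hom_def)
    ultimately show "\<psi> \<otimes>\<^bsub>AutoGroup G\<^esub> \<phi> \<in> {\<psi> \<in> auto G. \<forall>g\<in>carrier G. \<eta> (\<psi> g) = \<eta> g}"
      using * by (simp add: mult compose_def)
  qed (auto simp: car)
  from A.subgroup_imp_group[OF this] show ?thesis by (simp add: AutFix_def)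
qed

lemma twist_mult:
  assumes "\<psi> \<in> carrier (AutFix G \<eta>)" "\<phi> \<in> carrier (AutFix G \<eta>)"
  shows "twist G (\<psi> \<otimes>\<^bsub>AutFix G \<eta>\<^esub> \<phi>) f = twist G \<phi> (twist G \<psi> f)"
proof -
  have "\<psi> \<otimes>\<^bsub>AutFix G \<eta>\<^esub> \<phi> = compose (carrier G) \<psi> \<phi>"
    using assms by (simp add: AutFix_def AutoGroup_def BijGroup_def auto_def)
  moreover have "\<phi> g \<in> carrier G" if "g \<in> carrier G" for g
    using assms(2) that by (auto simp: AutFix_def auto_def hom_def)
  ultimately show ?thesis
    by (auto simp: twist_def compose_def restrict_def fun_eq_iff)
qed

end

locale finite_ring_action = ring_action +
  assumes finite: "finite (carrier G)"
begin

abbreviation CP where "CP f \<equiv> crossed_product G R \<eta> f"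

lemma CP_simps:
  "carrier (CP f) = carrier G \<rightarrow>\<^sub>E carrier R"
  "x \<otimes>\<^bsub>CP f\<^esub> y = (\<lambda>k \<in> carrier G. \<Oplus>\<^bsub>R\<^esub>g \<in> carrier G.
     x g \<otimes>\<^bsub>R\<^esub> \<eta> g (y (inv\<^bsub>G\<^esub> g \<otimes>\<^bsub>G\<^esub> k)) \<otimes>\<^bsub>R\<^esub> f (g, inv\<^bsub>G\<^esub> g \<otimes>\<^bsub>G\<^esub> k))"
  "\<one>\<^bsub>CP f\<^esub> = (\<lambda>k \<in> carrier G. if k = \<one>\<^bsub>G\<^esub> then inv\<^bsub>R\<^esub> (f (\<one>\<^bsub>G\<^esub>, \<one>\<^bsub>G\<^esub>)) else \<zero>\<^bsub>R\<^esub>)"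
  "\<zero>\<^bsub>CP f\<^esub> = (\<lambda>k \<in> carrier G. \<zero>\<^bsub>R\<^esub>)"
  "x \<oplus>\<^bsub>CP f\<^esub> y = (\<lambda>k \<in> carrier G. x k \<oplus>\<^bsub>R\<^esub> y k)"
  "a \<odot>\<^bsub>CP f\<^esub> x = (\<lambda>k \<in> carrier G. a \<otimes>\<^bsub>R\<^esub> x k)"
  by (simp_all add: crossed_product_def)

lemma CP_eqI:
  assumes "x \<in> carrier (CP f)" "y \<in> carrier (CP f)" "\<And>k. k \<in> carrier G \<Longrightarrow> x k = y k"
  shows "x = y"
  using assms unfolding CP_simps(1) by (rule PiE_ext)

lemma CP_coeff: "x \<in> carrier (CP f) \<Longrightarrow> g \<in> carrier G \<Longrightarrow> x g \<in> carrier R"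
  by (auto simp: CP_simps)

lemma CP_term:
  assumes "f \<in> cocycles G R \<eta>" "x \<in> carrier (CP f)" "y \<in> carrier (CP f)" "g \<in> carrier G" "k \<in> carrier G"
  shows "x g \<otimes>\<^bsub>R\<^esub> \<eta> g (y (inv\<^bsub>G\<^esub> g \<otimes>\<^bsub>G\<^esub> k)) \<otimes>\<^bsub>R\<^esub> f (g, inv\<^bsub>G\<^esub> g \<otimes>\<^bsub>G\<^esub> k) \<in> carrier R"
  using assms by (simp add: CP_coeff cocycles_closed)

lemma CP_mult_closed:
  assumes "f \<in> cocycles G R \<eta>" "x \<in> carrier (CP f)" "y \<in> carrier (CP f)"
  shows "x \<otimes>\<^bsub>CP f\<^esub> y \<in> carrier (CP f)"
  using CP_term[OF assms]
  by (subst CP_simps(1)) (auto simp: CP_simps(2) intro!: R.finsum_closed)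

lemma act_finsum:
  assumes "g \<in> carrier G" "F \<in> A \<rightarrow> carrier R"
  shows "\<eta> g (finsum R F A) = finsum R (\<lambda>i. \<eta> g (F i)) A"
  using assms(2)
proof (induction A rule: infinite_finite_induct)
  case (insert i A)
  then have "(\<lambda>i. \<eta> g (F i)) \<in> A \<rightarrow> carrier R" "\<eta> g (F i) \<in> carrier R" "finsum R F A \<in> carrier R"
    using assms(1) by (auto simp: Pi_iff intro!: act_closed)
  with insert assms(1) show ?case by (simp add: act_add)
qed (use assms(1) in auto)

lemma finsum_swap:
  assumes "finite A" "finite B" "\<And>i j. i \<in> A \<Longrightarrow> j \<in> B \<Longrightarrow> F i j \<in> carrier R"
  shows "(\<Oplus>\<^bsub>R\<^esub>i\<in>A. \<Oplus>\<^bsub>R\<^esub>j\<in>B. F i j) = (\<Oplus>\<^bsub>R\<^esub>j\<in>B. \<Oplus>\<^bsub>R\<^esub>i\<in>A. F i j)"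
  using assms(1,3)
proof (induction A rule: finite_induct)
  case (insert a A)
  have m: "(\<lambda>i. \<Oplus>\<^bsub>R\<^esub>j\<in>B. F i j) \<in> A \<rightarrow> carrier R" "(\<Oplus>\<^bsub>R\<^esub>j\<in>B. F a j) \<in> carrier R"
    "(\<lambda>j. \<Oplus>\<^bsub>R\<^esub>i\<in>A. F i j) \<in> B \<rightarrow> carrier R" "(\<lambda>j. F a j) \<in> B \<rightarrow> carrier R"
    using insert.prems by (auto intro!: R.finsum_closed)
  have "(\<Oplus>\<^bsub>R\<^esub>j\<in>B. \<Oplus>\<^bsub>R\<^esub>i\<in>insert a A. F i j) = (\<Oplus>\<^bsub>R\<^esub>j\<in>B. F a j \<oplus>\<^bsub>R\<^esub> (\<Oplus>\<^bsub>R\<^esub>i\<in>A. F i j))"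
  proof (rule R.finsum_cong')
    show "(\<lambda>j. F a j \<oplus>\<^bsub>R\<^esub> (\<Oplus>\<^bsub>R\<^esub>i\<in>A. F i j)) \<in> B \<rightarrow> carrier R"
      using m by (auto simp: Pi_iff)
    show "(\<Oplus>\<^bsub>R\<^esub>i\<in>insert a A. F i j) = F a j \<oplus>\<^bsub>R\<^esub> (\<Oplus>\<^bsub>R\<^esub>i\<in>A. F i j)" if "j \<in> B" for j
      using insert that by (intro R.finsum_insert) auto
  qed simp
  also have "\<dots> = (\<Oplus>\<^bsub>R\<^esub>j\<in>B. F a j) \<oplus>\<^bsub>R\<^esub> (\<Oplus>\<^bsub>R\<^esub>j\<in>B. \<Oplus>\<^bsub>R\<^esub>i\<in>A. F i j)"
    by (rule R.finsum_addf[OF m(4,3)])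
  finally show ?case using insert m by simp
qed simp

lemma finsum_translate:
  assumes "g \<in> carrier G" "F \<in> carrier G \<rightarrow> carrier R"
  shows "(\<Oplus>\<^bsub>R\<^esub>h\<in>carrier G. F (inv\<^bsub>G\<^esub> g \<otimes>\<^bsub>G\<^esub> h)) = finsum R F (carrier G)"
proof -
  have img: "(\<lambda>h. inv\<^bsub>G\<^esub> g \<otimes>\<^bsub>G\<^esub> h) ` carrier G = carrier G"
    using G.surj_const_mult[of "inv\<^bsub>G\<^esub> g"] assms(1) by simp
  moreover have "inj_on (\<lambda>h. inv\<^bsub>G\<^esub> g \<otimes>\<^bsub>G\<^esub> h) (carrier G)"
    using G.inj_on_cmult[of "inv\<^bsub>G\<^esub> g"] assms(1) by simp
  ultimately show ?thesis
    using R.add.finprod_reindex[of F "\<lambda>h. inv\<^bsub>G\<^esub> g \<otimes>\<^bsub>G\<^esub> h" "carrier G"] assms(2)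
    unfolding finsum_def by simp
qed

lemma CP_assoc:
  assumes f: "f \<in> cocycles G R \<eta>"
    and x: "x \<in> carrier (CP f)" and y: "y \<in> carrier (CP f)" and z: "z \<in> carrier (CP f)"
  shows "(x \<otimes>\<^bsub>CP f\<^esub> y) \<otimes>\<^bsub>CP f\<^esub> z = x \<otimes>\<^bsub>CP f\<^esub> (y \<otimes>\<^bsub>CP f\<^esub> z)"
proof (rule CP_eqI[of _ f])
  fix k assume k: "k \<in> carrier G"
  note cl = CP_coeff[OF x] CP_coeff[OF y] CP_coeff[OF z] cocycles_closed[OF f]
  define T where "T g h = x g \<otimes>\<^bsub>R\<^esub> \<eta> g (y (inv\<^bsub>G\<^esub> g \<otimes>\<^bsub>G\<^esub> h)) \<otimes>\<^bsub>R\<^esub> f (g, inv\<^bsub>G\<^esub> g \<otimes>\<^bsub>G\<^esub> h) \<otimes>\<^bsub>R\<^esub>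
    (\<eta> h (z (inv\<^bsub>G\<^esub> h \<otimes>\<^bsub>G\<^esub> k)) \<otimes>\<^bsub>R\<^esub> f (h, inv\<^bsub>G\<^esub> h \<otimes>\<^bsub>G\<^esub> k))" for g h
  have T: "T g h \<in> carrier R" if "g \<in> carrier G" "h \<in> carrier G" for g h
    using that k by (simp add: T_def cl)
  have "((x \<otimes>\<^bsub>CP f\<^esub> y) \<otimes>\<^bsub>CP f\<^esub> z) k = (\<Oplus>\<^bsub>R\<^esub>h\<in>carrier G. \<Oplus>\<^bsub>R\<^esub>g\<in>carrier G. T g h)"
    unfolding CP_simps(2)[where x="x \<otimes>\<^bsub>CP f\<^esub> y"] restrict_apply'[OF k]
  proof (rule R.finsum_cong')
    show "(\<lambda>h. \<Oplus>\<^bsub>R\<^esub>g\<in>carrier G. T g h) \<in> carrier G \<rightarrow> carrier R"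
      using T by (auto intro!: R.finsum_closed)
    fix h assume h: "h \<in> carrier G"
    let ?S = "\<lambda>g. x g \<otimes>\<^bsub>R\<^esub> \<eta> g (y (inv\<^bsub>G\<^esub> g \<otimes>\<^bsub>G\<^esub> h)) \<otimes>\<^bsub>R\<^esub> f (g, inv\<^bsub>G\<^esub> g \<otimes>\<^bsub>G\<^esub> h)"
    let ?c = "\<eta> h (z (inv\<^bsub>G\<^esub> h \<otimes>\<^bsub>G\<^esub> k)) \<otimes>\<^bsub>R\<^esub> f (h, inv\<^bsub>G\<^esub> h \<otimes>\<^bsub>G\<^esub> k)"
    have c: "\<eta> h (z (inv\<^bsub>G\<^esub> h \<otimes>\<^bsub>G\<^esub> k)) \<in> carrier R" "f (h, inv\<^bsub>G\<^esub> h \<otimes>\<^bsub>G\<^esub> k) \<in> carrier R"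
      using h k by (simp_all add: cl)
    have S: "?S \<in> carrier G \<rightarrow> carrier R" using CP_term[OF f x y _ h] by auto
    have "(x \<otimes>\<^bsub>CP f\<^esub> y) h \<otimes>\<^bsub>R\<^esub> \<eta> h (z (inv\<^bsub>G\<^esub> h \<otimes>\<^bsub>G\<^esub> k)) \<otimes>\<^bsub>R\<^esub> f (h, inv\<^bsub>G\<^esub> h \<otimes>\<^bsub>G\<^esub> k) =
      finsum R ?S (carrier G) \<otimes>\<^bsub>R\<^esub> ?c"
      unfolding CP_simps(2)[where x=x] restrict_apply'[OF h]
      using R.finsum_closed[OF S] c by (simp add: R.m_assoc)
    also have "\<dots> = (\<Oplus>\<^bsub>R\<^esub>g\<in>carrier G. T g h)"
      using R.finsum_ldistr[OF finite _ S, of ?c] c by (simp add: T_def)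
    finally show "(x \<otimes>\<^bsub>CP f\<^esub> y) h \<otimes>\<^bsub>R\<^esub> \<eta> h (z (inv\<^bsub>G\<^esub> h \<otimes>\<^bsub>G\<^esub> k)) \<otimes>\<^bsub>R\<^esub> f (h, inv\<^bsub>G\<^esub> h \<otimes>\<^bsub>G\<^esub> k) =
      (\<Oplus>\<^bsub>R\<^esub>g\<in>carrier G. T g h)" .
  qed simp
  also have "\<dots> = (\<Oplus>\<^bsub>R\<^esub>g\<in>carrier G. \<Oplus>\<^bsub>R\<^esub>h\<in>carrier G. T g h)"
    by (rule finsum_swap) (auto simp: finite T)
  also have "\<dots> = (x \<otimes>\<^bsub>CP f\<^esub> (y \<otimes>\<^bsub>CP f\<^esub> z)) k"
    unfolding CP_simps(2)[where x=x] restrict_apply'[OF k]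
  proof (rule R.finsum_cong'[symmetric])
    show "(\<lambda>g. \<Oplus>\<^bsub>R\<^esub>h\<in>carrier G. T g h) \<in> carrier G \<rightarrow> carrier R"
      using T by (auto intro!: R.finsum_closed)
    fix g assume g: "g \<in> carrier G"
    let ?k = "inv\<^bsub>G\<^esub> g \<otimes>\<^bsub>G\<^esub> k"
    let ?S = "\<lambda>h. y h \<otimes>\<^bsub>R\<^esub> \<eta> h (z (inv\<^bsub>G\<^esub> h \<otimes>\<^bsub>G\<^esub> ?k)) \<otimes>\<^bsub>R\<^esub> f (h, inv\<^bsub>G\<^esub> h \<otimes>\<^bsub>G\<^esub> ?k)"
    have k': "?k \<in> carrier G" using g k by simp
    have S: "?S \<in> carrier G \<rightarrow> carrier R" using CP_term[OF f y z _ k'] by auto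
    have S': "(\<lambda>h. ?S (inv\<^bsub>G\<^esub> g \<otimes>\<^bsub>G\<^esub> h)) \<in> carrier G \<rightarrow> carrier R"
      using S g by (auto simp only: Pi_iff)
    have fc: "f (g, ?k) \<in> carrier R" using g k' by (simp add: cl)
    have \<eta>S: "(\<lambda>h. \<eta> g (?S (inv\<^bsub>G\<^esub> g \<otimes>\<^bsub>G\<^esub> h))) \<in> carrier G \<rightarrow> carrier R"
      using S' g by (auto simp only: Pi_iff intro!: act_closed)
    have "x g \<otimes>\<^bsub>R\<^esub> \<eta> g ((y \<otimes>\<^bsub>CP f\<^esub> z) ?k) \<otimes>\<^bsub>R\<^esub> f (g, ?k) =
      (x g \<otimes>\<^bsub>R\<^esub> f (g, ?k)) \<otimes>\<^bsub>R\<^esub> \<eta> g (finsum R ?S (carrier G))"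
      unfolding CP_simps(2)[where x=y] restrict_apply'[OF k']
      using g fc R.finsum_closed[OF S] cl(1)[OF g] act_closed[OF g R.finsum_closed[OF S]]
      by (simp only: R.m_ac)
    also have "finsum R ?S (carrier G) = (\<Oplus>\<^bsub>R\<^esub>h\<in>carrier G. ?S (inv\<^bsub>G\<^esub> g \<otimes>\<^bsub>G\<^esub> h))"
      by (rule finsum_translate[OF g S, symmetric])
    also have "(x g \<otimes>\<^bsub>R\<^esub> f (g, ?k)) \<otimes>\<^bsub>R\<^esub> \<eta> g \<dots> =
      (\<Oplus>\<^bsub>R\<^esub>h\<in>carrier G. (x g \<otimes>\<^bsub>R\<^esub> f (g, ?k)) \<otimes>\<^bsub>R\<^esub> \<eta> g (?S (inv\<^bsub>G\<^esub> g \<otimes>\<^bsub>G\<^esub> h)))"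
      unfolding act_finsum[OF g S']
      by (rule R.finsum_rdistr[OF finite _ \<eta>S]) (use fc g cl in simp)
    also have "\<dots> = (\<Oplus>\<^bsub>R\<^esub>h\<in>carrier G. T g h)"
    proof (rule R.finsum_cong')
      show "(\<lambda>h. T g h) \<in> carrier G \<rightarrow> carrier R" using T g by auto
      fix h assume h: "h \<in> carrier G"
      let ?h = "inv\<^bsub>G\<^esub> g \<otimes>\<^bsub>G\<^esub> h" and ?l = "inv\<^bsub>G\<^esub> h \<otimes>\<^bsub>G\<^esub> k"
      have h': "?h \<in> carrier G" and l: "?l \<in> carrier G" using g h k by simp_all
      have cancel: "a \<otimes>\<^bsub>G\<^esub> (inv\<^bsub>G\<^esub> a \<otimes>\<^bsub>G\<^esub> b) = b" if "a \<in> carrier G" "b \<in> carrier G" for a b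
        using that by (simp add: G.m_assoc[symmetric])
      have e1: "inv\<^bsub>G\<^esub> ?h \<otimes>\<^bsub>G\<^esub> ?k = ?l"
        using g h k by (simp add: G.inv_mult_group G.m_assoc cancel)
      have e1': "g \<otimes>\<^bsub>G\<^esub> ?h = h" "?h \<otimes>\<^bsub>G\<^esub> ?l = ?k"
        using g h k by (simp_all add: G.m_assoc cancel)
      have co: "f (g, ?h) \<otimes>\<^bsub>R\<^esub> f (h, ?l) = \<eta> g (f (?h, ?l)) \<otimes>\<^bsub>R\<^esub> f (g, ?k)"
        using cocycle[OF f g h' l] by (simp add: e1')
      have mm: "x g \<in> carrier R" "\<eta> g (y ?h) \<in> carrier R" "\<eta> h (z ?l) \<in> carrier R"
        "f (g, ?h) \<in> carrier R" "f (h, ?l) \<in> carrier R" "\<eta> g (f (?h, ?l)) \<in> carrier R" "f (g, ?k) \<in> carrier R"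
        "y ?h \<in> carrier R" "\<eta> ?h (z ?l) \<in> carrier R" "f (?h, ?l) \<in> carrier R" "z ?l \<in> carrier R"
        using g h h' l k' by (simp_all only: cl act_closed)
      have "\<eta> g (?S ?h) = \<eta> g (y ?h) \<otimes>\<^bsub>R\<^esub> \<eta> h (z ?l) \<otimes>\<^bsub>R\<^esub> \<eta> g (f (?h, ?l))"
        using act_act[OF g h' mm(11)] mm
        by (simp only: e1 e1' act_mult[OF g] R.m_closed)
      then have "(x g \<otimes>\<^bsub>R\<^esub> f (g, ?k)) \<otimes>\<^bsub>R\<^esub> \<eta> g (?S ?h) =
        x g \<otimes>\<^bsub>R\<^esub> \<eta> g (y ?h) \<otimes>\<^bsub>R\<^esub> \<eta> h (z ?l) \<otimes>\<^bsub>R\<^esub> (\<eta> g (f (?h, ?l)) \<otimes>\<^bsub>R\<^esub> f (g, ?k))"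
        using mm by (simp only: R.m_ac R.m_closed)
      also have "\<dots> = T g h"
        using mm unfolding co[symmetric] T_def by (simp only: R.m_ac R.m_closed)
      finally show "(x g \<otimes>\<^bsub>R\<^esub> f (g, ?k)) \<otimes>\<^bsub>R\<^esub> \<eta> g (?S ?h) = T g h" .
    qed simp
    finally show "x g \<otimes>\<^bsub>R\<^esub> \<eta> g ((y \<otimes>\<^bsub>CP f\<^esub> z) ?k) \<otimes>\<^bsub>R\<^esub> f (g, ?k) = (\<Oplus>\<^bsub>R\<^esub>h\<in>carrier G. T g h)" .
  qed simp
  finally show "((x \<otimes>\<^bsub>CP f\<^esub> y) \<otimes>\<^bsub>CP f\<^esub> z) k = (x \<otimes>\<^bsub>CP f\<^esub> (y \<otimes>\<^bsub>CP f\<^esub> z)) k" .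
qed (use f x y z in \<open>auto intro!: CP_mult_closed\<close>)

lemma finsum_single:
  assumes "finite A" "i \<in> A" "F \<in> A \<rightarrow> carrier R" "\<And>j. j \<in> A \<Longrightarrow> j \<noteq> i \<Longrightarrow> F j = \<zero>\<^bsub>R\<^esub>"
  shows "finsum R F A = F i"
proof -
  have "finsum R F A = (\<Oplus>\<^bsub>R\<^esub>j\<in>A. if i = j then F j else \<zero>\<^bsub>R\<^esub>)"
    using assms by (intro R.finsum_cong') (auto simp: Pi_iff)
  also have "\<dots> = F i" using R.add.finprod_singleton[of i A F] assms by (simp add: finsum_def)
  finally show ?thesis .
qed

lemma Units_right_cancel:
  assumes "a \<in> carrier R" "b \<in> carrier R" "u \<in> Units R" "a \<otimes>\<^bsub>R\<^esub> u = b \<otimes>\<^bsub>R\<^esub> u" shows "a = b"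
  using assms R.Units_l_cancel[of u a b] R.m_comm R.Units_closed by metis

lemma cocycle_one_left:
  assumes f: "f \<in> cocycles G R \<eta>" and k: "k \<in> carrier G"
  shows "f (\<one>\<^bsub>G\<^esub>, k) = f (\<one>\<^bsub>G\<^esub>, \<one>\<^bsub>G\<^esub>)"
  using Units_right_cancel[of "f (\<one>\<^bsub>G\<^esub>, k)" "f (\<one>\<^bsub>G\<^esub>, \<one>\<^bsub>G\<^esub>)" "f (\<one>\<^bsub>G\<^esub>, k)"]
    cocycle[OF f, of "\<one>\<^bsub>G\<^esub>" "\<one>\<^bsub>G\<^esub>" k] k cocycles_closed[OF f] cocycles_Units[OF f]
  by simp

lemma cocycle_one_right:
  assumes f: "f \<in> cocycles G R \<eta>" and g: "g \<in> carrier G"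
  shows "f (g, \<one>\<^bsub>G\<^esub>) = \<eta> g (f (\<one>\<^bsub>G\<^esub>, \<one>\<^bsub>G\<^esub>))"
  using Units_right_cancel[of "f (g, \<one>\<^bsub>G\<^esub>)" "\<eta> g (f (\<one>\<^bsub>G\<^esub>, \<one>\<^bsub>G\<^esub>))" "f (g, \<one>\<^bsub>G\<^esub>)"]
    cocycle[OF f, of g "\<one>\<^bsub>G\<^esub>" "\<one>\<^bsub>G\<^esub>"] g cocycles_closed[OF f] cocycles_Units[OF f]
  by simp

lemma CP_one_closed: "f \<in> cocycles G R \<eta> \<Longrightarrow> \<one>\<^bsub>CP f\<^esub> \<in> carrier (CP f)"
  by (auto simp: CP_simps cocycles_Units R.Units_inv_closed)

lemma CP_l_one:
  assumes f: "f \<in> cocycles G R \<eta>" and x: "x \<in> carrier (CP f)"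
  shows "\<one>\<^bsub>CP f\<^esub> \<otimes>\<^bsub>CP f\<^esub> x = x"
proof (rule CP_eqI[OF CP_mult_closed[OF f CP_one_closed[OF f] x] x])
  fix k assume k: "k \<in> carrier G"
  let ?F = "\<lambda>g. \<one>\<^bsub>CP f\<^esub> g \<otimes>\<^bsub>R\<^esub> \<eta> g (x (inv\<^bsub>G\<^esub> g \<otimes>\<^bsub>G\<^esub> k)) \<otimes>\<^bsub>R\<^esub> f (g, inv\<^bsub>G\<^esub> g \<otimes>\<^bsub>G\<^esub> k)"
  note u = cocycles_Units[OF f, of "\<one>\<^bsub>G\<^esub>" "\<one>\<^bsub>G\<^esub>"]
  have "(\<one>\<^bsub>CP f\<^esub> \<otimes>\<^bsub>CP f\<^esub> x) k = finsum R ?F (carrier G)"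
    using k by (simp add: CP_simps(2))
  also have "\<dots> = ?F \<one>\<^bsub>G\<^esub>"
    by (rule finsum_single)
       (use CP_term[OF f CP_one_closed[OF f] x _ k] k in
         \<open>auto simp: finite CP_simps(3) CP_coeff[OF x] cocycles_closed[OF f]\<close>)
  also have "\<dots> = inv\<^bsub>R\<^esub> (f (\<one>\<^bsub>G\<^esub>, \<one>\<^bsub>G\<^esub>)) \<otimes>\<^bsub>R\<^esub> x k \<otimes>\<^bsub>R\<^esub> f (\<one>\<^bsub>G\<^esub>, \<one>\<^bsub>G\<^esub>)"
    using k by (simp add: CP_simps(3) CP_coeff[OF x] cocycle_one_left[OF f k])
  also have "\<dots> = (inv\<^bsub>R\<^esub> (f (\<one>\<^bsub>G\<^esub>, \<one>\<^bsub>G\<^esub>)) \<otimes>\<^bsub>R\<^esub> f (\<one>\<^bsub>G\<^esub>, \<one>\<^bsub>G\<^esub>)) \<otimes>\<^bsub>R\<^esub> x k"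
    using u CP_coeff[OF x k] R.Units_inv_closed R.Units_closed
    by (simp add: R.m_ac del: R.Units_r_inv R.Units_l_inv)
  also have "\<dots> = x k" using u CP_coeff[OF x k] by simp
  finally show "(\<one>\<^bsub>CP f\<^esub> \<otimes>\<^bsub>CP f\<^esub> x) k = x k" .
qed

lemma CP_r_one:
  assumes f: "f \<in> cocycles G R \<eta>" and x: "x \<in> carrier (CP f)"
  shows "x \<otimes>\<^bsub>CP f\<^esub> \<one>\<^bsub>CP f\<^esub> = x"
proof (rule CP_eqI[OF CP_mult_closed[OF f x CP_one_closed[OF f]] x])
  fix k assume k: "k \<in> carrier G"
  let ?F = "\<lambda>g. x g \<otimes>\<^bsub>R\<^esub> \<eta> g (\<one>\<^bsub>CP f\<^esub> (inv\<^bsub>G\<^esub> g \<otimes>\<^bsub>G\<^esub> k)) \<otimes>\<^bsub>R\<^esub> f (g, inv\<^bsub>G\<^esub> g \<otimes>\<^bsub>G\<^esub> k)"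
  note u = cocycles_Units[OF f, of "\<one>\<^bsub>G\<^esub>" "\<one>\<^bsub>G\<^esub>"]
  have ne: "inv\<^bsub>G\<^esub> g \<otimes>\<^bsub>G\<^esub> k \<noteq> \<one>\<^bsub>G\<^esub>" if "g \<in> carrier G" "g \<noteq> k" for g
    using that k G.inv_equality[of "inv\<^bsub>G\<^esub> g" k] G.inv_inv G.inv_closed
    by (metis G.inv_solve_left' G.one_closed G.r_one)
  have "(x \<otimes>\<^bsub>CP f\<^esub> \<one>\<^bsub>CP f\<^esub>) k = finsum R ?F (carrier G)"
    using k by (simp add: CP_simps(2))
  also have "\<dots> = ?F k"
    by (rule finsum_single)
       (use CP_term[OF f x CP_one_closed[OF f] _ k] k in
         \<open>auto simp: finite CP_simps(3) CP_coeff[OF x] cocycles_closed[OF f] ne\<close>)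
  also have "\<dots> = x k \<otimes>\<^bsub>R\<^esub> (\<eta> k (inv\<^bsub>R\<^esub> (f (\<one>\<^bsub>G\<^esub>, \<one>\<^bsub>G\<^esub>))) \<otimes>\<^bsub>R\<^esub> \<eta> k (f (\<one>\<^bsub>G\<^esub>, \<one>\<^bsub>G\<^esub>)))"
    using k u R.Units_closed
    by (simp add: CP_simps(3) CP_coeff[OF x] cocycle_one_right[OF f k] R.m_assoc)
  also have "\<dots> = x k"
    using k u R.Units_closed CP_coeff[OF x k] by (simp add: act_mult[symmetric])
  finally show "(x \<otimes>\<^bsub>CP f\<^esub> \<one>\<^bsub>CP f\<^esub>) k = x k" .
qed

lemma CP_add_closed: "x \<in> carrier (CP f) \<Longrightarrow> y \<in> carrier (CP f) \<Longrightarrow> x \<oplus>\<^bsub>CP f\<^esub> y \<in> carrier (CP f)"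
  by (auto simp: CP_simps Pi_iff)

lemma abelian_group_CP: "abelian_group (CP f)"
proof (rule abelian_groupI)
  fix x y z assume x: "x \<in> carrier (CP f)" and y: "y \<in> carrier (CP f)" and z: "z \<in> carrier (CP f)"
  show "x \<oplus>\<^bsub>CP f\<^esub> y \<in> carrier (CP f)" by (rule CP_add_closed[OF x y])
  show "(x \<oplus>\<^bsub>CP f\<^esub> y) \<oplus>\<^bsub>CP f\<^esub> z = x \<oplus>\<^bsub>CP f\<^esub> (y \<oplus>\<^bsub>CP f\<^esub> z)"
    by (rule CP_eqI[of _ f]) (use x y z in
      \<open>auto simp: CP_simps(1,5) PiE_mem[of _ "carrier G" "\<lambda>_. carrier R"] R.a_assoc\<close>)
  show "x \<oplus>\<^bsub>CP f\<^esub> y = y \<oplus>\<^bsub>CP f\<^esub> x"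
    using CP_coeff[OF x] CP_coeff[OF y] by (auto simp: CP_simps(5) fun_eq_iff restrict_def R.a_comm)
next
  show z: "\<zero>\<^bsub>CP f\<^esub> \<in> carrier (CP f)" by (auto simp: CP_simps)
  fix x assume x: "x \<in> carrier (CP f)"
  show "\<zero>\<^bsub>CP f\<^esub> \<oplus>\<^bsub>CP f\<^esub> x = x"
    by (rule CP_eqI[of _ f]) (use x CP_coeff[OF x] in
      \<open>auto simp: CP_simps(1,4,5)\<close>)
  show "\<exists>y\<in>carrier (CP f). y \<oplus>\<^bsub>CP f\<^esub> x = \<zero>\<^bsub>CP f\<^esub>"
    using CP_coeff[OF x]
    by (intro bexI[of _ "\<lambda>k\<in>carrier G. \<ominus>\<^bsub>R\<^esub> x k"])
       (auto simp: CP_simps R.l_neg fun_eq_iff restrict_def[of _ "carrier G"])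
qed

lemma ring_CP:
  assumes f: "f \<in> cocycles G R \<eta>"
  shows "ring (CP f)"
proof (rule ringI)
  show "abelian_group (CP f)" by (rule abelian_group_CP)
  show "monoid (CP f)"
    by (rule monoidI) (simp_all add: f CP_mult_closed CP_one_closed CP_assoc CP_l_one CP_r_one)
  fix x y z assume x: "x \<in> carrier (CP f)" and y: "y \<in> carrier (CP f)" and z: "z \<in> carrier (CP f)"
  note cl = CP_coeff[OF x] CP_coeff[OF y] CP_coeff[OF z] cocycles_closed[OF f]
  show "(x \<oplus>\<^bsub>CP f\<^esub> y) \<otimes>\<^bsub>CP f\<^esub> z = x \<otimes>\<^bsub>CP f\<^esub> z \<oplus>\<^bsub>CP f\<^esub> y \<otimes>\<^bsub>CP f\<^esub> z"
  proof (rule CP_eqI[of _ f])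
    fix k assume k: "k \<in> carrier G"
    have "(x \<otimes>\<^bsub>CP f\<^esub> z \<oplus>\<^bsub>CP f\<^esub> y \<otimes>\<^bsub>CP f\<^esub> z) k = (\<Oplus>\<^bsub>R\<^esub>g\<in>carrier G.
       x g \<otimes>\<^bsub>R\<^esub> \<eta> g (z (inv\<^bsub>G\<^esub> g \<otimes>\<^bsub>G\<^esub> k)) \<otimes>\<^bsub>R\<^esub> f (g, inv\<^bsub>G\<^esub> g \<otimes>\<^bsub>G\<^esub> k) \<oplus>\<^bsub>R\<^esub>
       y g \<otimes>\<^bsub>R\<^esub> \<eta> g (z (inv\<^bsub>G\<^esub> g \<otimes>\<^bsub>G\<^esub> k)) \<otimes>\<^bsub>R\<^esub> f (g, inv\<^bsub>G\<^esub> g \<otimes>\<^bsub>G\<^esub> k))"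
      using k CP_term[OF f x z _ k] CP_term[OF f y z _ k]
      by (subst R.finsum_addf) (auto simp: CP_simps(2,5))
    also have "\<dots> = ((x \<oplus>\<^bsub>CP f\<^esub> y) \<otimes>\<^bsub>CP f\<^esub> z) k"
      unfolding CP_simps(2) restrict_apply'[OF k]
      by (rule R.finsum_cong') (use k in \<open>auto simp: CP_simps(5) cl R.l_distr R.m_assoc\<close>)
    finally show "((x \<oplus>\<^bsub>CP f\<^esub> y) \<otimes>\<^bsub>CP f\<^esub> z) k = (x \<otimes>\<^bsub>CP f\<^esub> z \<oplus>\<^bsub>CP f\<^esub> y \<otimes>\<^bsub>CP f\<^esub> z) k" ..
  qed (use f x y z in \<open>auto intro!: CP_mult_closed CP_add_closed\<close>)
  show "z \<otimes>\<^bsub>CP f\<^esub> (x \<oplus>\<^bsub>CP f\<^esub> y) = z \<otimes>\<^bsub>CP f\<^esub> x \<oplus>\<^bsub>CP f\<^esub> z \<otimes>\<^bsub>CP f\<^esub> y"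
  proof (rule CP_eqI[of _ f])
    fix k assume k: "k \<in> carrier G"
    have "(z \<otimes>\<^bsub>CP f\<^esub> x \<oplus>\<^bsub>CP f\<^esub> z \<otimes>\<^bsub>CP f\<^esub> y) k = (\<Oplus>\<^bsub>R\<^esub>g\<in>carrier G.
       z g \<otimes>\<^bsub>R\<^esub> \<eta> g (x (inv\<^bsub>G\<^esub> g \<otimes>\<^bsub>G\<^esub> k)) \<otimes>\<^bsub>R\<^esub> f (g, inv\<^bsub>G\<^esub> g \<otimes>\<^bsub>G\<^esub> k) \<oplus>\<^bsub>R\<^esub>
       z g \<otimes>\<^bsub>R\<^esub> \<eta> g (y (inv\<^bsub>G\<^esub> g \<otimes>\<^bsub>G\<^esub> k)) \<otimes>\<^bsub>R\<^esub> f (g, inv\<^bsub>G\<^esub> g \<otimes>\<^bsub>G\<^esub> k))"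
      using k CP_term[OF f z x _ k] CP_term[OF f z y _ k]
      by (subst R.finsum_addf) (auto simp: CP_simps(2,5))
    also have "\<dots> = (z \<otimes>\<^bsub>CP f\<^esub> (x \<oplus>\<^bsub>CP f\<^esub> y)) k"
      unfolding CP_simps(2) restrict_apply'[OF k]
      by (rule R.finsum_cong') (use k in \<open>auto simp: CP_simps(5) cl act_add R.r_distr R.l_distr\<close>)
    finally show "(z \<otimes>\<^bsub>CP f\<^esub> (x \<oplus>\<^bsub>CP f\<^esub> y)) k = (z \<otimes>\<^bsub>CP f\<^esub> x \<oplus>\<^bsub>CP f\<^esub> z \<otimes>\<^bsub>CP f\<^esub> y) k" ..
  qed (use f x y z in \<open>auto intro!: CP_mult_closed CP_add_closed\<close>)
qed

lemma module_CP: "module R (CP f)"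
proof (rule moduleI)
  show "cring R" by (rule R.is_cring)
  show "abelian_group (CP f)" by (rule abelian_group_CP)
  show "\<one>\<^bsub>R\<^esub> \<odot>\<^bsub>CP f\<^esub> x = x" if x: "x \<in> carrier (CP f)" for x
    by (rule CP_eqI[of _ f]) (use x CP_coeff[OF x] in \<open>auto simp: CP_simps\<close>)
qed (auto simp: CP_simps fun_eq_iff PiE_mem[of _ "carrier G" "\<lambda>_. carrier R"] R.l_distr R.r_distr R.m_assoc)

definition u :: "'a \<Rightarrow> 'a \<Rightarrow> 'c" where
  "u g = (\<lambda>k \<in> carrier G. if k = g then \<one>\<^bsub>R\<^esub> else \<zero>\<^bsub>R\<^esub>)"

lemma u_mult:
  assumes f: "f \<in> cocycles G R \<eta>" and g: "g \<in> carrier G" and h: "h \<in> carrier G"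
    and \<beta>: "\<beta> \<in> carrier R" and \<gamma>: "\<gamma> \<in> carrier R"
  shows "(\<beta> \<odot>\<^bsub>CP f\<^esub> u g) \<otimes>\<^bsub>CP f\<^esub> (\<gamma> \<odot>\<^bsub>CP f\<^esub> u h) =
    (\<beta> \<otimes>\<^bsub>R\<^esub> \<eta> g \<gamma> \<otimes>\<^bsub>R\<^esub> f (g, h)) \<odot>\<^bsub>CP f\<^esub> u (g \<otimes>\<^bsub>G\<^esub> h)"
proof (rule CP_eqI[of _ f])
  have bu: "a \<odot>\<^bsub>CP f\<^esub> u g \<in> carrier (CP f)" if "a \<in> carrier R" for a g
    using that by (auto simp: CP_simps u_def)
  show "(\<beta> \<odot>\<^bsub>CP f\<^esub> u g) \<otimes>\<^bsub>CP f\<^esub> (\<gamma> \<odot>\<^bsub>CP f\<^esub> u h) \<in> carrier (CP f)"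
    using CP_mult_closed[OF f] bu \<beta> \<gamma> by blast
  show "(\<beta> \<otimes>\<^bsub>R\<^esub> \<eta> g \<gamma> \<otimes>\<^bsub>R\<^esub> f (g, h)) \<odot>\<^bsub>CP f\<^esub> u (g \<otimes>\<^bsub>G\<^esub> h) \<in> carrier (CP f)"
    using g h \<beta> \<gamma> cocycles_closed[OF f] by (intro bu) simp
  fix k assume k: "k \<in> carrier G"
  let ?F = "\<lambda>i. (\<beta> \<odot>\<^bsub>CP f\<^esub> u g) i \<otimes>\<^bsub>R\<^esub> \<eta> i ((\<gamma> \<odot>\<^bsub>CP f\<^esub> u h) (inv\<^bsub>G\<^esub> i \<otimes>\<^bsub>G\<^esub> k)) \<otimes>\<^bsub>R\<^esub> f (i, inv\<^bsub>G\<^esub> i \<otimes>\<^bsub>G\<^esub> k)"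
  have eq: "inv\<^bsub>G\<^esub> g \<otimes>\<^bsub>G\<^esub> k = h \<longleftrightarrow> k = g \<otimes>\<^bsub>G\<^esub> h"
    using g h k G.inv_solve_left'[of h g k] by blast
  have "((\<beta> \<odot>\<^bsub>CP f\<^esub> u g) \<otimes>\<^bsub>CP f\<^esub> (\<gamma> \<odot>\<^bsub>CP f\<^esub> u h)) k = finsum R ?F (carrier G)"
    using k by (simp add: CP_simps(2))
  also have "\<dots> = ?F g"
    by (rule finsum_single[OF finite g])
      (use CP_term[OF f bu[OF \<beta>] bu[OF \<gamma>] _ k] k in
         \<open>auto simp: CP_simps(6) u_def \<beta> \<gamma> cocycles_closed[OF f]\<close>)
  also have "\<dots> = ((\<beta> \<otimes>\<^bsub>R\<^esub> \<eta> g \<gamma> \<otimes>\<^bsub>R\<^esub> f (g, h)) \<odot>\<^bsub>CP f\<^esub> u (g \<otimes>\<^bsub>G\<^esub> h)) k"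
    using g h k \<beta> \<gamma> eq cocycles_closed[OF f] by (auto simp: CP_simps(6) u_def)
  finally show "((\<beta> \<odot>\<^bsub>CP f\<^esub> u g) \<otimes>\<^bsub>CP f\<^esub> (\<gamma> \<odot>\<^bsub>CP f\<^esub> u h)) k =
    ((\<beta> \<otimes>\<^bsub>R\<^esub> \<eta> g \<gamma> \<otimes>\<^bsub>R\<^esub> f (g, h)) \<odot>\<^bsub>CP f\<^esub> u (g \<otimes>\<^bsub>G\<^esub> h)) k" .
qed

lemma CP_smult_one_mult:
  assumes f: "f \<in> cocycles G R \<eta>" and a: "a \<in> carrier R" and x: "x \<in> carrier (CP f)"
  shows "(a \<odot>\<^bsub>CP f\<^esub> \<one>\<^bsub>CP f\<^esub>) \<otimes>\<^bsub>CP f\<^esub> x = a \<odot>\<^bsub>CP f\<^esub> x"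
proof -
  interpret M: module R "CP f" by (rule module_CP)
  have "(a \<odot>\<^bsub>CP f\<^esub> \<one>\<^bsub>CP f\<^esub>) \<otimes>\<^bsub>CP f\<^esub> x = a \<odot>\<^bsub>CP f\<^esub> (\<one>\<^bsub>CP f\<^esub> \<otimes>\<^bsub>CP f\<^esub> x)"
  proof (rule CP_eqI[of _ f])
    fix k assume k: "k \<in> carrier G"
    note o = CP_one_closed[OF f]
    let ?F = "\<lambda>g. \<one>\<^bsub>CP f\<^esub> g \<otimes>\<^bsub>R\<^esub> \<eta> g (x (inv\<^bsub>G\<^esub> g \<otimes>\<^bsub>G\<^esub> k)) \<otimes>\<^bsub>R\<^esub> f (g, inv\<^bsub>G\<^esub> g \<otimes>\<^bsub>G\<^esub> k)"
    have F: "?F \<in> carrier G \<rightarrow> carrier R" using CP_term[OF f o x _ k] by auto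
    have "(a \<odot>\<^bsub>CP f\<^esub> (\<one>\<^bsub>CP f\<^esub> \<otimes>\<^bsub>CP f\<^esub> x)) k = a \<otimes>\<^bsub>R\<^esub> finsum R ?F (carrier G)"
      using k by (simp add: CP_simps(2,6))
    also have "\<dots> = (\<Oplus>\<^bsub>R\<^esub>g\<in>carrier G. a \<otimes>\<^bsub>R\<^esub> ?F g)"
      by (rule R.finsum_rdistr[OF finite a F])
    also have "\<dots> = ((a \<odot>\<^bsub>CP f\<^esub> \<one>\<^bsub>CP f\<^esub>) \<otimes>\<^bsub>CP f\<^esub> x) k"
      unfolding CP_simps(2)[where x="a \<odot>\<^bsub>CP f\<^esub> \<one>\<^bsub>CP f\<^esub>"] restrict_apply'[OF k]
      by (rule R.finsum_cong')
         (use k a CP_coeff[OF o] CP_coeff[OF x] cocycles_closed[OF f] in \<open>auto simp: CP_simps(6) R.m_assoc\<close>)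
    finally show "((a \<odot>\<^bsub>CP f\<^esub> \<one>\<^bsub>CP f\<^esub>) \<otimes>\<^bsub>CP f\<^esub> x) k = (a \<odot>\<^bsub>CP f\<^esub> (\<one>\<^bsub>CP f\<^esub> \<otimes>\<^bsub>CP f\<^esub> x)) k" ..
  qed (use f a x CP_one_closed in \<open>auto intro!: CP_mult_closed M.smult_closed\<close>)
  then show ?thesis by (simp add: CP_l_one[OF f x])
qed

lemma equiv_isometry_rel: "equiv (crossed_products G R \<eta>) (isometry_rel G R \<eta>)"
proof (rule equivI)
  show "isometry_rel G R \<eta> \<subseteq> crossed_products G R \<eta> \<times> crossed_products G R \<eta>"
    by (auto simp: isometry_rel_def)
  have "isometric G R A A" for A
    unfolding isometric_def isometry_def
    by (intro exI[of _ "\<lambda>x. x"]) (auto simp: ring_hom_def bij_betw_def)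
  then show "refl_on (crossed_products G R \<eta>) (isometry_rel G R \<eta>)"
    by (auto simp: refl_on_def isometry_rel_def)
  show "sym (isometry_rel G R \<eta>)"
  proof (rule symI)
    fix A B assume "(A, B) \<in> isometry_rel G R \<eta>"
    then obtain \<phi> where AB: "A \<in> crossed_products G R \<eta>" "B \<in> crossed_products G R \<eta>"
      and \<phi>: "isometry G R A B \<phi>"
      by (auto simp: isometry_rel_def isometric_def)
    obtain f where f: "f \<in> cocycles G R \<eta>" "A = CP f" using AB by (auto simp: crossed_products_def)
    interpret A: ring A using ring_CP f by simp
    interpret MA: module R A using module_CP f by simp
    let ?i = "inv_into (carrier A) \<phi>"
    have b: "bij_betw \<phi> (carrier A) (carrier B)" and h: "\<phi> \<in> ring_hom A B"
      using \<phi> by (auto simp: isometry_def)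
    have i: "?i y \<in> carrier A" "\<phi> (?i y) = y" if "y \<in> carrier B" for y
      using b that by (auto simp: bij_betw_def inv_into_into f_inv_into_f)
    have i': "?i (\<phi> x) = x" if "x \<in> carrier A" for x
      using b that by (simp add: bij_betw_def inv_into_f_f)
    have "?i \<in> ring_iso B A"
      by (rule ring_iso_set_sym) (use A.ring_axioms b h in \<open>auto simp: ring_iso_def\<close>)
    moreover have "?i (a \<odot>\<^bsub>B\<^esub> y) = a \<odot>\<^bsub>A\<^esub> ?i y" if "a \<in> carrier R" "y \<in> carrier B" for a y
    proof -
      have "\<phi> (a \<odot>\<^bsub>A\<^esub> ?i y) = a \<odot>\<^bsub>B\<^esub> y"
        using \<phi> that i by (auto simp: isometry_def)
      then show ?thesis using i'[of "a \<odot>\<^bsub>A\<^esub> ?i y"] that i by simp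
    qed
    moreover have "hamming_weight G R (?i y) = hamming_weight G R y" if "y \<in> carrier B" for y
      using \<phi> i[OF that] by (metis isometry_def)
    ultimately have "isometry G R B A ?i" by (auto simp: isometry_def ring_iso_def)
    then show "(B, A) \<in> isometry_rel G R \<eta>"
      using AB by (auto simp: isometry_rel_def isometric_def)
  qed
  show "trans (isometry_rel G R \<eta>)"
  proof (rule transI)
    fix A B C assume "(A, B) \<in> isometry_rel G R \<eta>" "(B, C) \<in> isometry_rel G R \<eta>"
    then obtain \<phi> \<psi> where AC: "A \<in> crossed_products G R \<eta>" "C \<in> crossed_products G R \<eta>"
      and \<phi>: "isometry G R A B \<phi>" and \<psi>: "isometry G R B C \<psi>"
      by (auto simp: isometry_rel_def isometric_def)
    have c: "\<phi> x \<in> carrier B" if "x \<in> carrier A" for x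
      using \<phi> that by (auto simp: isometry_def bij_betw_def)
    have "isometry G R A C (\<psi> \<circ> \<phi>)"
      using \<phi> \<psi> c by (auto simp: isometry_def bij_betw_trans ring_hom_trans)
    then show "(A, C) \<in> isometry_rel G R \<eta>"
      using AC by (auto simp: isometry_rel_def isometric_def)
  qed
qed

end

end

theory Submission
  imports Defs
begin

text \<open>An isometry sends the basis element \<open>u\<^sub>g\<close> to an element of weight one, say
  \<open>c\<^sub>g u\<^bsub>\<psi> g\<^esub>\<close>. Pulling basis elements back along it shows that \<open>\<psi>\<close> is a permutation and that
  all \<open>c\<^sub>g\<close> are units. Applying it to \<open>u\<^sub>g a = g(a) u\<^sub>g\<close> gives \<open>\<eta> \<circ> \<psi> = \<eta>\<close>, and applying it to
  \<open>u\<^sub>g u\<^sub>h = f(g, h) u\<^bsub>gh\<^esub>\<close> shows that \<open>\<psi>\<close> is multiplicative and that \<open>f\<close> differs from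
  \<open>\<psi>(f')\<close> by the coboundary of \<open>c\<close>. Conversely, such data define the isometry
  \<open>u\<^sub>g \<mapsto> c\<^sub>g u\<^bsub>\<psi> g\<^esub>\<close>.\<close>

section \<open>Cohomologous cocycles and automorphisms preserving the action\<close>

context ring_action
begin

text \<open>Cosets of \<open>B2\<close> agree exactly when one representative is a coboundary times
  the other. Multiplying by the unit \<open>r (gh)\<close> clears the inverse and leaves the
  relation that appears when a map rescales basis elements by \<open>r\<close>; both directions of
  the main equivalence use this form.\<close>

lemma H2_class_eq_iff:
  assumes f: "f \<in> cocycles G R \<eta>" and f': "f' \<in> cocycles G R \<eta>"
  shows "H2_class G R \<eta> f = H2_class G R \<eta> f' \<longleftrightarrow>
    (\<exists>r \<in> carrier G \<rightarrow> Units R. \<forall>g \<in> carrier G. \<forall>h \<in> carrier G.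
       f (g, h) \<otimes>\<^bsub>R\<^esub> r (g \<otimes>\<^bsub>G\<^esub> h) = r g \<otimes>\<^bsub>R\<^esub> \<eta> g (r h) \<otimes>\<^bsub>R\<^esub> f' (g, h))"
proof -
  interpret Z2: comm_group "Z2 G R \<eta>" by (rule comm_group_Z2)
  have pointwise: "f = coboundary G R \<eta> r \<otimes>\<^bsub>Z2 G R \<eta>\<^esub> f' \<longleftrightarrow>
    (\<forall>g \<in> carrier G. \<forall>h \<in> carrier G.
       f (g, h) \<otimes>\<^bsub>R\<^esub> r (g \<otimes>\<^bsub>G\<^esub> h) = r g \<otimes>\<^bsub>R\<^esub> \<eta> g (r h) \<otimes>\<^bsub>R\<^esub> f' (g, h))"
    if r: "r \<in> carrier G \<rightarrow> Units R" for r
  proof -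
    have "f = coboundary G R \<eta> r \<otimes>\<^bsub>Z2 G R \<eta>\<^esub> f' \<longleftrightarrow> (\<forall>g \<in> carrier G. \<forall>h \<in> carrier G.
       f (g, h) = r g \<otimes>\<^bsub>R\<^esub> \<eta> g (r h) \<otimes>\<^bsub>R\<^esub> inv\<^bsub>R\<^esub> (r (g \<otimes>\<^bsub>G\<^esub> h)) \<otimes>\<^bsub>R\<^esub> f' (g, h))"
      using cocycles_ext[OF f]
      by (auto simp: Z2_simps coboundary_def fun_eq_iff restrict_def extensional_def)
    also have "\<dots> \<longleftrightarrow> (\<forall>g \<in> carrier G. \<forall>h \<in> carrier G.
       f (g, h) \<otimes>\<^bsub>R\<^esub> r (g \<otimes>\<^bsub>G\<^esub> h) = r g \<otimes>\<^bsub>R\<^esub> \<eta> g (r h) \<otimes>\<^bsub>R\<^esub> f' (g, h))"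
    proof (intro ball_cong refl)
      fix g h assume gh: "g \<in> carrier G" "h \<in> carrier G"
      let ?r = "r (g \<otimes>\<^bsub>G\<^esub> h)" and ?b = "r g \<otimes>\<^bsub>R\<^esub> \<eta> g (r h)"
      have r': "?r \<in> Units R" "?r \<in> carrier R" "inv\<^bsub>R\<^esub> ?r \<in> carrier R"
        using r gh by (auto simp: Pi_iff)
      have c: "?b \<in> carrier R" "f (g, h) \<in> carrier R" "f' (g, h) \<in> carrier R"
        using r gh cocycles_closed[OF f] cocycles_closed[OF f'] by (auto simp: Pi_iff R.Units_closed)
      have "?b \<otimes>\<^bsub>R\<^esub> inv\<^bsub>R\<^esub> ?r \<otimes>\<^bsub>R\<^esub> f' (g, h) \<otimes>\<^bsub>R\<^esub> ?r = ?b \<otimes>\<^bsub>R\<^esub> f' (g, h) \<otimes>\<^bsub>R\<^esub> (inv\<^bsub>R\<^esub> ?r \<otimes>\<^bsub>R\<^esub> ?r)"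
        using r' c by (simp only: R.m_ac R.m_closed)
      also have "\<dots> = ?b \<otimes>\<^bsub>R\<^esub> f' (g, h)" using r' c by simp
      finally have e: "?b \<otimes>\<^bsub>R\<^esub> inv\<^bsub>R\<^esub> ?r \<otimes>\<^bsub>R\<^esub> f' (g, h) \<otimes>\<^bsub>R\<^esub> ?r = ?b \<otimes>\<^bsub>R\<^esub> f' (g, h)" .
      have "x = y \<longleftrightarrow> x \<otimes>\<^bsub>R\<^esub> ?r = y \<otimes>\<^bsub>R\<^esub> ?r" if "x \<in> carrier R" "y \<in> carrier R" for x y
        using R.Units_l_cancel[OF r'(1), of x y] that r' by (simp add: R.m_comm)
      from this[of "f (g, h)" "?b \<otimes>\<^bsub>R\<^esub> inv\<^bsub>R\<^esub> ?r \<otimes>\<^bsub>R\<^esub> f' (g, h)"]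
      show "f (g, h) = ?b \<otimes>\<^bsub>R\<^esub> inv\<^bsub>R\<^esub> ?r \<otimes>\<^bsub>R\<^esub> f' (g, h) \<longleftrightarrow> f (g, h) \<otimes>\<^bsub>R\<^esub> ?r = ?b \<otimes>\<^bsub>R\<^esub> f' (g, h)"
        using r' c by (simp only: e R.m_closed)
    qed
    finally show ?thesis .
  qed
  have "H2_class G R \<eta> f = H2_class G R \<eta> f' \<longleftrightarrow> f \<in> H2_class G R \<eta> f'"
    using Z2.repr_independence[OF _ _ subgroup_B2] Z2.rcos_self[OF _ subgroup_B2] f f'
    unfolding H2_class_def Z2_simps(1) by metis
  also have "\<dots> \<longleftrightarrow> (\<exists>r \<in> carrier G \<rightarrow> Units R. f = coboundary G R \<eta> r \<otimes>\<^bsub>Z2 G R \<eta>\<^esub> f')"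
    by (auto simp: H2_class_def r_coset_def B2_def)
  also have "\<dots> \<longleftrightarrow> (\<exists>r \<in> carrier G \<rightarrow> Units R. \<forall>g \<in> carrier G. \<forall>h \<in> carrier G.
       f (g, h) \<otimes>\<^bsub>R\<^esub> r (g \<otimes>\<^bsub>G\<^esub> h) = r g \<otimes>\<^bsub>R\<^esub> \<eta> g (r h) \<otimes>\<^bsub>R\<^esub> f' (g, h))"
    using pointwise by (intro bex_cong refl) blast
  finally show ?thesis .
qed

lemma AutFixD:
  assumes "\<psi> \<in> carrier (AutFix G \<eta>)"
  shows AutFix_bij: "bij_betw \<psi> (carrier G) (carrier G)"
    and AutFix_closed: "g \<in> carrier G \<Longrightarrow> \<psi> g \<in> carrier G"
    and AutFix_mult: "g \<in> carrier G \<Longrightarrow> h \<in> carrier G \<Longrightarrow> \<psi> (g \<otimes>\<^bsub>G\<^esub> h) = \<psi> g \<otimes>\<^bsub>G\<^esub> \<psi> h"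
    and AutFix_act: "g \<in> carrier G \<Longrightarrow> \<eta> (\<psi> g) = \<eta> g"
    and AutFix_hom: "\<psi> \<in> hom G G"
  using assms by (auto simp: AutFix_def auto_def hom_def Bij_def)

end

section \<open>Monomials and elements of weight one\<close>

context finite_ring_action
begin

lemma smult_u_closed: "a \<in> carrier R \<Longrightarrow> a \<odot>\<^bsub>CP f\<^esub> u g \<in> carrier (CP f)"
  by (auto simp: CP_simps u_def)

lemma u_closed: "u g \<in> carrier (CP f)"
  by (auto simp: CP_simps u_def)

lemma smult_smult_u:
  "a \<in> carrier R \<Longrightarrow> b \<in> carrier R \<Longrightarrow> a \<odot>\<^bsub>CP f\<^esub> (b \<odot>\<^bsub>CP f\<^esub> u g) = (a \<otimes>\<^bsub>R\<^esub> b) \<odot>\<^bsub>CP f\<^esub> u g"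
  by (auto simp: CP_simps u_def fun_eq_iff restrict_def)

lemma one_smult_u: "\<one>\<^bsub>R\<^esub> \<odot>\<^bsub>CP f\<^esub> u g = u g"
  by (auto simp: CP_simps u_def fun_eq_iff restrict_def)

lemma CP_one_eq:
  "f \<in> cocycles G R \<eta> \<Longrightarrow> \<one>\<^bsub>CP f\<^esub> = inv\<^bsub>R\<^esub> (f (\<one>\<^bsub>G\<^esub>, \<one>\<^bsub>G\<^esub>)) \<odot>\<^bsub>CP f\<^esub> u \<one>\<^bsub>G\<^esub>"
  by (auto simp: CP_simps u_def fun_eq_iff restrict_def cocycles_Units)

text \<open>The coefficient at \<open>g\<close> is nonzero on the left, which forces
  \<open>h = g\<close> on the right; a zero multiple would carry no index. Scalar multiplication
  does not involve the cocycle, so \<open>f\<close> and \<open>f'\<close> may differ.\<close>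

lemma smult_u_inject:
  assumes "a \<odot>\<^bsub>CP f\<^esub> u g = b \<odot>\<^bsub>CP f'\<^esub> u h"
    and "g \<in> carrier G" "h \<in> carrier G" "a \<in> carrier R" "b \<in> carrier R" "a \<noteq> \<zero>\<^bsub>R\<^esub>"
  shows "g = h \<and> a = b"
  using fun_cong[OF assms(1), of g] assms(2-) by (auto simp: CP_simps u_def split: if_splits)

lemma hamming_weight_u:
  assumes "g \<in> carrier G" "\<one>\<^bsub>R\<^esub> \<noteq> \<zero>\<^bsub>R\<^esub>"
  shows "hamming_weight G R (u g) = 1"
proof -
  have "{k \<in> carrier G. u g k \<noteq> \<zero>\<^bsub>R\<^esub>} = {g}"
    using assms by (auto simp: u_def)
  then show ?thesis by (simp add: hamming_weight_def)
qed

text \<open>The support is a singleton and \<open>c\<close> is the coefficient there. Through this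
  fact the preservation of weights forces basis elements, and their preimages, to correspond to
  monomials.\<close>

lemma hamming_weight_1E:
  assumes x: "x \<in> carrier (CP f)" and "hamming_weight G R x = 1"
  obtains c g where "c \<in> carrier R" "g \<in> carrier G" "x = c \<odot>\<^bsub>CP f\<^esub> u g"
proof -
  obtain g where g: "{k \<in> carrier G. x k \<noteq> \<zero>\<^bsub>R\<^esub>} = {g}"
    using assms(2) card_1_singletonE unfolding hamming_weight_def by blast
  then have gG: "g \<in> carrier G" by auto
  have "x k = (x g \<odot>\<^bsub>CP f\<^esub> u g) k" if "k \<in> carrier G" for k
    using that g gG CP_coeff[OF x] by (auto simp: CP_simps u_def)
  then have "x = x g \<odot>\<^bsub>CP f\<^esub> u g"
    using CP_eqI[OF x smult_u_closed] CP_coeff[OF x gG] by blast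
  then show ?thesis using that CP_coeff[OF x gG] gG by blast
qed

text \<open>This is the relation \<open>u_g a = g(a) u_g\<close>, with \<open>a\<close> embedded as
  \<open>a 1\<close>. Cocycles need not be normalized, so \<open>1\<close> is
  \<open>f(e,e)^-1 u_e\<close>; the factor \<open>f(g,e) = g(f(e,e))\<close> of the product cancels
  the image of that inverse under \<open>g\<close>.\<close>

lemma u_mult_scalar:
  assumes f: "f \<in> cocycles G R \<eta>" and g: "g \<in> carrier G" and c: "c \<in> carrier R" and a: "a \<in> carrier R"
  shows "(c \<odot>\<^bsub>CP f\<^esub> u g) \<otimes>\<^bsub>CP f\<^esub> (a \<odot>\<^bsub>CP f\<^esub> \<one>\<^bsub>CP f\<^esub>) = (c \<otimes>\<^bsub>R\<^esub> \<eta> g a) \<odot>\<^bsub>CP f\<^esub> u g"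
proof -
  let ?f = "f (\<one>\<^bsub>G\<^esub>, \<one>\<^bsub>G\<^esub>)"
  have U: "?f \<in> Units R" using cocycles_Units[OF f] by simp
  then have C: "?f \<in> carrier R" "inv\<^bsub>R\<^esub> ?f \<in> carrier R" by auto
  have "\<eta> g (a \<otimes>\<^bsub>R\<^esub> inv\<^bsub>R\<^esub> ?f) \<otimes>\<^bsub>R\<^esub> f (g, \<one>\<^bsub>G\<^esub>) = \<eta> g (a \<otimes>\<^bsub>R\<^esub> inv\<^bsub>R\<^esub> ?f \<otimes>\<^bsub>R\<^esub> ?f)"
    using C a g by (simp only: cocycle_one_right[OF f g] act_mult[OF g] R.m_closed)
  also have "\<dots> = \<eta> g a" using U C a by (simp add: R.m_assoc)
  finally have "c \<otimes>\<^bsub>R\<^esub> \<eta> g (a \<otimes>\<^bsub>R\<^esub> inv\<^bsub>R\<^esub> ?f) \<otimes>\<^bsub>R\<^esub> f (g, \<one>\<^bsub>G\<^esub>) = c \<otimes>\<^bsub>R\<^esub> \<eta> g a"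
    using C a g c cocycles_closed[OF f, of g "\<one>\<^bsub>G\<^esub>"] by (simp add: R.m_assoc)
  then show ?thesis
    using u_mult[OF f g G.one_closed c, of "a \<otimes>\<^bsub>R\<^esub> inv\<^bsub>R\<^esub> ?f"] a C g
    by (simp add: CP_one_eq[OF f] smult_smult_u)
qed

section \<open>From an isometry to a twisted cocycle\<close>

lemma isometry_imp_twist:
  assumes one_zero: "\<one>\<^bsub>R\<^esub> \<noteq> \<zero>\<^bsub>R\<^esub>"
    and f: "f \<in> cocycles G R \<eta>" and f': "f' \<in> cocycles G R \<eta>"
    and \<phi>: "isometry G R (CP f) (CP f') \<phi>"
  shows "\<exists>\<psi> \<in> carrier (AutFix G \<eta>). H2_class G R \<eta> f = H2_class G R \<eta> (twist G \<psi> f')"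
proof -
  have bij: "bij_betw \<phi> (carrier (CP f)) (carrier (CP f'))"
    and hom: "\<phi> \<in> ring_hom (CP f) (CP f')"
    and lin: "\<And>a x. a \<in> carrier R \<Longrightarrow> x \<in> carrier (CP f) \<Longrightarrow> \<phi> (a \<odot>\<^bsub>CP f\<^esub> x) = a \<odot>\<^bsub>CP f'\<^esub> \<phi> x"
    and wt: "\<And>x. x \<in> carrier (CP f) \<Longrightarrow> hamming_weight G R (\<phi> x) = hamming_weight G R x"
    using \<phi> by (auto simp: isometry_def)
  have mult: "\<phi> (x \<otimes>\<^bsub>CP f\<^esub> y) = \<phi> x \<otimes>\<^bsub>CP f'\<^esub> \<phi> y"
    if "x \<in> carrier (CP f)" "y \<in> carrier (CP f)" for x y
    using hom that by (rule ring_hom_mult)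
  have "\<exists>c k. c \<in> carrier R \<and> k \<in> carrier G \<and> \<phi> (u g) = c \<odot>\<^bsub>CP f'\<^esub> u k" if g: "g \<in> carrier G" for g
    using hamming_weight_1E[of "\<phi> (u g)" f'] wt[OF u_closed] hamming_weight_u[OF g one_zero]
      ring_hom_closed[OF hom u_closed] by metis
  then obtain c \<psi>0 where c0: "\<And>g. g \<in> carrier G \<Longrightarrow>
      c g \<in> carrier R \<and> \<psi>0 g \<in> carrier G \<and> \<phi> (u g) = c g \<odot>\<^bsub>CP f'\<^esub> u (\<psi>0 g)"
    by metis
  \<comment> \<open>Members of \<open>auto G\<close> are extensional, so the chosen index function
    is cut off outside the carrier.\<close>
  define \<psi> where "\<psi> = restrict \<psi>0 (carrier G)"
  have c: "c g \<in> carrier R" and \<psi>: "\<psi> g \<in> carrier G" and \<phi>u: "\<phi> (u g) = c g \<odot>\<^bsub>CP f'\<^esub> u (\<psi> g)"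
    if "g \<in> carrier G" for g
    using c0[OF that] that by (simp_all add: \<psi>_def)
  have \<phi>au: "\<phi> (a \<odot>\<^bsub>CP f\<^esub> u g) = (a \<otimes>\<^bsub>R\<^esub> c g) \<odot>\<^bsub>CP f'\<^esub> u (\<psi> g)"
    if "a \<in> carrier R" "g \<in> carrier G" for a g
    using that by (simp add: lin u_closed \<phi>u smult_smult_u c)
  \<comment> \<open>The preimage of \<open>u h\<close> again has weight one, so it is a monomial
    \<open>d u_g\<close>, which \<open>\<phi>\<close> sends to \<open>d c_g u_{\<psi> g}\<close>.
    Comparing with \<open>1 u_h\<close> gives both claims.\<close>
  have pull: "\<exists>d\<in>carrier R. \<exists>g\<in>carrier G. \<psi> g = h \<and> d \<otimes>\<^bsub>R\<^esub> c g = \<one>\<^bsub>R\<^esub>" if h: "h \<in> carrier G" for h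
  proof -
    obtain y where y: "y \<in> carrier (CP f)" "\<phi> y = u h"
      using bij u_closed[of h f'] by (metis bij_betw_def imageE)
    then obtain d g where d: "d \<in> carrier R" "g \<in> carrier G" "y = d \<odot>\<^bsub>CP f\<^esub> u g"
      using hamming_weight_1E wt hamming_weight_u[OF h one_zero] by metis
    have "\<one>\<^bsub>R\<^esub> \<odot>\<^bsub>CP f'\<^esub> u h = (d \<otimes>\<^bsub>R\<^esub> c g) \<odot>\<^bsub>CP f'\<^esub> u (\<psi> g)"
      using y d \<phi>au by (simp add: one_smult_u)
    from smult_u_inject[OF this] h d c \<psi> one_zero
    show ?thesis by (metis R.m_closed R.one_closed)
  qed
  then have surj: "\<psi> ` carrier G = carrier G" using \<psi> by blast
  then have inj: "inj_on \<psi> (carrier G)" using finite by (simp add: eq_card_imp_inj_on)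
  \<comment> \<open>Applied at \<open>\<psi> g\<close>, \<open>pull\<close> inverts \<open>c\<close>
    at some index with the same image under \<open>\<psi>\<close>. Injectivity, which comes from
    finiteness of \<open>G\<close>, identifies that index with \<open>g\<close>.\<close>
  have cU: "c g \<in> Units R" if g: "g \<in> carrier G" for g
  proof -
    obtain d where "d \<in> carrier R" "d \<otimes>\<^bsub>R\<^esub> c g = \<one>\<^bsub>R\<^esub>"
      using pull[OF \<psi>[OF g]] inj g by (metis inj_onD)
    then show ?thesis using c[OF g] R.m_comm unfolding Units_def by auto
  qed
  have nz: "x \<noteq> \<zero>\<^bsub>R\<^esub>" if "x \<in> Units R" for x
    using that one_zero by (metis R.Units_inv_closed R.Units_l_inv R.r_null)
  \<comment> \<open>Both functions are extensional, so comparing them on the carrier suffices. There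
    the image of \<open>g(a) u_g = u_g a\<close> is computed in two ways and the unit
    \<open>c g\<close> is cancelled.\<close>
  have act: "\<eta> (\<psi> g) = \<eta> g" if g: "g \<in> carrier G" for g
  proof (rule extensionalityI[OF act_ext act_ext])
    fix a assume a: "a \<in> carrier R"
    have oc: "a \<odot>\<^bsub>CP f\<^esub> \<one>\<^bsub>CP f\<^esub> \<in> carrier (CP f)"
      using a CP_coeff[OF CP_one_closed[OF f]] by (simp add: CP_simps(1,6))
    have "(\<eta> g a \<otimes>\<^bsub>R\<^esub> c g) \<odot>\<^bsub>CP f'\<^esub> u (\<psi> g) = \<phi> (\<eta> g a \<odot>\<^bsub>CP f\<^esub> u g)"
      using g a by (simp add: \<phi>au)
    also have "\<eta> g a \<odot>\<^bsub>CP f\<^esub> u g = u g \<otimes>\<^bsub>CP f\<^esub> (a \<odot>\<^bsub>CP f\<^esub> \<one>\<^bsub>CP f\<^esub>)"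
      using u_mult_scalar[OF f g R.one_closed a] g a by (simp add: one_smult_u)
    also have "\<phi> \<dots> = (c g \<odot>\<^bsub>CP f'\<^esub> u (\<psi> g)) \<otimes>\<^bsub>CP f'\<^esub> (a \<odot>\<^bsub>CP f'\<^esub> \<one>\<^bsub>CP f'\<^esub>)"
      using ring_hom_one[OF hom] by (simp add: mult u_closed oc lin a CP_one_closed f \<phi>u g)
    also have "\<dots> = (c g \<otimes>\<^bsub>R\<^esub> \<eta> (\<psi> g) a) \<odot>\<^bsub>CP f'\<^esub> u (\<psi> g)"
      using g a c \<psi> by (intro u_mult_scalar f') auto
    finally have "(\<eta> g a \<otimes>\<^bsub>R\<^esub> c g) \<odot>\<^bsub>CP f'\<^esub> u (\<psi> g) = (c g \<otimes>\<^bsub>R\<^esub> \<eta> (\<psi> g) a) \<odot>\<^bsub>CP f'\<^esub> u (\<psi> g)" .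
    \<comment> \<open>The coefficients may vanish, so \<open>smult_u_inject\<close> does not apply;
      as both sides carry the same index, they are read off directly.\<close>
    from fun_cong[OF this, of "\<psi> g"]
    have "\<eta> g a \<otimes>\<^bsub>R\<^esub> c g = c g \<otimes>\<^bsub>R\<^esub> \<eta> (\<psi> g) a"
      using g a c \<psi> by (simp add: CP_simps(6) u_def)
    then show "\<eta> (\<psi> g) a = \<eta> g a"
      using R.Units_l_cancel[OF cU[OF g], of "\<eta> (\<psi> g) a" "\<eta> g a"] g a c \<psi>
      by (simp add: R.m_comm)
  qed (use g \<psi> in auto)
  \<comment> \<open>The image of \<open>f(g,h) u_{gh} = u_g u_h\<close> is computed by linearity and
    by multiplicativity. The coefficient from linearity is a product of units, hence nonzero, so
    indices and coefficients can both be compared.\<close>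
  have key: "\<psi> (g \<otimes>\<^bsub>G\<^esub> h) = \<psi> g \<otimes>\<^bsub>G\<^esub> \<psi> h \<and>
      f (g, h) \<otimes>\<^bsub>R\<^esub> c (g \<otimes>\<^bsub>G\<^esub> h) = c g \<otimes>\<^bsub>R\<^esub> \<eta> g (c h) \<otimes>\<^bsub>R\<^esub> f' (\<psi> g, \<psi> h)"
    if g: "g \<in> carrier G" and h: "h \<in> carrier G" for g h
  proof -
    have "(f (g, h) \<otimes>\<^bsub>R\<^esub> c (g \<otimes>\<^bsub>G\<^esub> h)) \<odot>\<^bsub>CP f'\<^esub> u (\<psi> (g \<otimes>\<^bsub>G\<^esub> h)) = \<phi> (f (g, h) \<odot>\<^bsub>CP f\<^esub> u (g \<otimes>\<^bsub>G\<^esub> h))"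
      using g h cocycles_closed[OF f] by (simp add: \<phi>au)
    also have "f (g, h) \<odot>\<^bsub>CP f\<^esub> u (g \<otimes>\<^bsub>G\<^esub> h) = u g \<otimes>\<^bsub>CP f\<^esub> u h"
      using u_mult[OF f g h R.one_closed R.one_closed] g h cocycles_closed[OF f]
      by (simp add: one_smult_u)
    also have "\<phi> \<dots> = (c g \<otimes>\<^bsub>R\<^esub> \<eta> g (c h) \<otimes>\<^bsub>R\<^esub> f' (\<psi> g, \<psi> h)) \<odot>\<^bsub>CP f'\<^esub> u (\<psi> g \<otimes>\<^bsub>G\<^esub> \<psi> h)"
      using u_mult[OF f' \<psi>[OF g] \<psi>[OF h] c[OF g] c[OF h]]
      by (simp add: mult u_closed \<phi>u g h act)
    finally show ?thesis
    proof (rule smult_u_inject)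
      show "f (g, h) \<otimes>\<^bsub>R\<^esub> c (g \<otimes>\<^bsub>G\<^esub> h) \<noteq> \<zero>\<^bsub>R\<^esub>"
        using g h cU cocycles_Units[OF f] by (intro nz) simp
    qed (use g h c \<psi> cocycles_closed[OF f] cocycles_closed[OF f'] in auto)
  qed
  have \<psi>A: "\<psi> \<in> carrier (AutFix G \<eta>)"
    using surj inj \<psi> key act by (auto simp: AutFix_def auto_def hom_def Bij_def bij_betw_def \<psi>_def)
  \<comment> \<open>The scaling factors \<open>c\<close> are the cochain whose coboundary relates
    \<open>f\<close> to the twist of \<open>f'\<close>.\<close>
  have "c \<in> carrier G \<rightarrow> Units R" using cU by auto
  then have "H2_class G R \<eta> f = H2_class G R \<eta> (twist G \<psi> f')"
    unfolding H2_class_eq_iff[OF f twist_closed[OF \<psi>A f']]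
    using key by (intro bexI[of _ c]) (auto simp: twist_def)
  then show ?thesis using \<psi>A by blast
qed

section \<open>From a twisted cocycle to an isometry\<close>

text \<open>Sending \<open>u_g\<close> to \<open>r_g u_{\<psi> g}\<close> permutes coordinates and
  scales them by units, which gives bijectivity and preservation of weights. Multiplicativity is the
  cocycle relation \<open>ff'\<close>.\<close>

lemma isometric_twist:
  assumes f: "f \<in> cocycles G R \<eta>" and f': "f' \<in> cocycles G R \<eta>"
    and \<psi>: "\<psi> \<in> carrier (AutFix G \<eta>)"
    and "H2_class G R \<eta> f = H2_class G R \<eta> (twist G \<psi> f')"
  shows "isometric G R (CP f) (CP f')"
proof -
  obtain r where r: "r \<in> carrier G \<rightarrow> Units R"
    and ff': "\<And>g h. g \<in> carrier G \<Longrightarrow> h \<in> carrier G \<Longrightarrow>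
      f (g, h) \<otimes>\<^bsub>R\<^esub> r (g \<otimes>\<^bsub>G\<^esub> h) = r g \<otimes>\<^bsub>R\<^esub> \<eta> g (r h) \<otimes>\<^bsub>R\<^esub> f' (\<psi> g, \<psi> h)"
    using assms(4) unfolding H2_class_eq_iff[OF f twist_closed[OF \<psi> f']] by (auto simp: twist_def)
  have rU: "r g \<in> Units R" and rC: "r g \<in> carrier R" if "g \<in> carrier G" for g
    using r that by (auto simp: Pi_iff)
  note b = AutFix_bij[OF \<psi>] and \<psi>c = AutFix_closed[OF \<psi>]
  define \<theta> where "\<theta> = inv_into (carrier G) \<psi>"
  have \<theta>c: "\<theta> k \<in> carrier G" and \<psi>\<theta>: "\<psi> (\<theta> k) = k" if "k \<in> carrier G" for k
    using b that by (auto simp: \<theta>_def bij_betw_def inv_into_into f_inv_into_f)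
  have \<theta>\<psi>: "\<theta> (\<psi> k) = k" if "k \<in> carrier G" for k
    using b that by (simp add: \<theta>_def bij_betw_def)
  have \<psi>inv: "\<psi> (inv\<^bsub>G\<^esub> g) = inv\<^bsub>G\<^esub> (\<psi> g)" if "g \<in> carrier G" for g
    using group_hom.hom_inv[of G G \<psi> g] AutFix_hom[OF \<psi>] that
    by (simp add: group_hom_def group_hom_axioms_def G.is_group)
  \<comment> \<open>In coordinates, the coefficient at \<open>k\<close> comes from the index
    \<open>\<theta> k\<close> that \<open>\<psi>\<close> moves to \<open>k\<close>.\<close>
  define \<phi> where "\<phi> x = (\<lambda>k\<in>carrier G. x (\<theta> k) \<otimes>\<^bsub>R\<^esub> r (\<theta> k))" for x
  have \<phi>c: "\<phi> x \<in> carrier (CP f')" if "x \<in> carrier (CP f)" for x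
    using CP_coeff[OF that] \<theta>c rC by (auto simp: \<phi>_def CP_simps)
  have \<phi>\<psi>: "\<phi> x (\<psi> k) = x k \<otimes>\<^bsub>R\<^esub> r k" if "k \<in> carrier G" for x k
    using that by (simp add: \<phi>_def \<psi>c \<theta>\<psi>)
  \<comment> \<open>Every index has the form \<open>\<psi> k\<close>, and at such indices
    \<open>\<phi>\<psi>\<close> evaluates \<open>\<phi>\<close> without
    \<open>\<theta>\<close>.\<close>
  have eqI: "x = y" if "x \<in> carrier (CP f')" "y \<in> carrier (CP f')"
      "\<And>k. k \<in> carrier G \<Longrightarrow> x (\<psi> k) = y (\<psi> k)" for x y
    using CP_eqI[OF that(1,2)] that(3)[OF \<theta>c] \<psi>\<theta> by metis
  have "bij_betw \<phi> (carrier (CP f)) (carrier (CP f'))"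
    unfolding bij_betw_def
  proof
    show "inj_on \<phi> (carrier (CP f))"
    proof (rule inj_onI)
      fix x y assume xy: "x \<in> carrier (CP f)" "y \<in> carrier (CP f)" "\<phi> x = \<phi> y"
      show "x = y"
      proof (rule CP_eqI[OF xy(1,2)])
        fix k assume k: "k \<in> carrier G"
        then have "x k \<otimes>\<^bsub>R\<^esub> r k = y k \<otimes>\<^bsub>R\<^esub> r k"
          using xy(3) \<phi>\<psi>[OF k, of x] \<phi>\<psi>[OF k, of y] by simp
        then show "x k = y k"
          by (rule Units_right_cancel[OF CP_coeff[OF xy(1) k] CP_coeff[OF xy(2) k] rU[OF k]])
      qed
    qed
    have "y \<in> \<phi> ` carrier (CP f)" if y: "y \<in> carrier (CP f')" for y
    proof
      let ?x = "\<lambda>k\<in>carrier G. y (\<psi> k) \<otimes>\<^bsub>R\<^esub> inv\<^bsub>R\<^esub> (r k)"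
      show x: "?x \<in> carrier (CP f)"
        using CP_coeff[OF y] rU \<psi>c by (auto simp: CP_simps)
      show "y = \<phi> ?x"
      proof (rule eqI[OF y \<phi>c[OF x]])
        fix k assume k: "k \<in> carrier G"
        then show "y (\<psi> k) = \<phi> ?x (\<psi> k)"
          using CP_coeff[OF y] rU[OF k] rC[OF k] \<psi>c by (simp add: \<phi>\<psi> R.m_assoc)
      qed
    qed
    then show "\<phi> ` carrier (CP f) = carrier (CP f')" using \<phi>c by blast
  qed
  moreover have "\<phi> \<in> ring_hom (CP f) (CP f')"
  proof (rule ring_hom_memI)
    fix x y assume x: "x \<in> carrier (CP f)" and y: "y \<in> carrier (CP f)"
    show "\<phi> (x \<oplus>\<^bsub>CP f\<^esub> y) = \<phi> x \<oplus>\<^bsub>CP f'\<^esub> \<phi> y"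
    proof (rule eqI)
      fix k assume k: "k \<in> carrier G"
      then show "\<phi> (x \<oplus>\<^bsub>CP f\<^esub> y) (\<psi> k) = (\<phi> x \<oplus>\<^bsub>CP f'\<^esub> \<phi> y) (\<psi> k)"
        using CP_coeff[OF x k] CP_coeff[OF y k] rC[OF k]
        by (simp add: CP_simps(5) \<psi>c \<phi>\<psi> R.l_distr)
    qed (intro \<phi>c CP_add_closed x y)+
    show "\<phi> (x \<otimes>\<^bsub>CP f\<^esub> y) = \<phi> x \<otimes>\<^bsub>CP f'\<^esub> \<phi> y"
    proof (rule eqI)
      fix k assume k: "k \<in> carrier G"
      let ?S = "\<lambda>g. x g \<otimes>\<^bsub>R\<^esub> \<eta> g (y (inv\<^bsub>G\<^esub> g \<otimes>\<^bsub>G\<^esub> k)) \<otimes>\<^bsub>R\<^esub> f (g, inv\<^bsub>G\<^esub> g \<otimes>\<^bsub>G\<^esub> k)"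
      let ?T = "\<lambda>h. \<phi> x h \<otimes>\<^bsub>R\<^esub> \<eta> h (\<phi> y (inv\<^bsub>G\<^esub> h \<otimes>\<^bsub>G\<^esub> \<psi> k)) \<otimes>\<^bsub>R\<^esub> f' (h, inv\<^bsub>G\<^esub> h \<otimes>\<^bsub>G\<^esub> \<psi> k)"
      have S: "?S \<in> carrier G \<rightarrow> carrier R" using CP_term[OF f x y _ k] by auto
      have T: "?T \<in> carrier G \<rightarrow> carrier R"
        using CP_term[OF f' \<phi>c[OF x] \<phi>c[OF y] _ \<psi>c[OF k]] by auto
      have "(\<phi> x \<otimes>\<^bsub>CP f'\<^esub> \<phi> y) (\<psi> k) = finsum R ?T (carrier G)"
        using \<psi>c[OF k] by (simp add: CP_simps(2))
      \<comment> \<open>Substituting \<open>h = \<psi> g\<close> matches the terms of this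
        convolution with those of the product in \<open>CP f\<close>, up to the common factor
        \<open>r k\<close>.\<close>
      also have "\<dots> = finsum R ?T (\<psi> ` carrier G)" using b by (simp add: bij_betw_def)
      also have "\<dots> = (\<Oplus>\<^bsub>R\<^esub>g\<in>carrier G. ?T (\<psi> g))"
        using b T by (intro R.finsum_reindex) (auto simp: bij_betw_def)
      also have "\<dots> = (\<Oplus>\<^bsub>R\<^esub>g\<in>carrier G. ?S g \<otimes>\<^bsub>R\<^esub> r k)"
      proof (rule R.finsum_cong')
        show "(\<lambda>g. ?S g \<otimes>\<^bsub>R\<^esub> r k) \<in> carrier G \<rightarrow> carrier R"
          using S rC[OF k] by (auto simp only: Pi_iff R.m_closed)
        fix g assume g: "g \<in> carrier G"
        let ?l = "inv\<^bsub>G\<^esub> g \<otimes>\<^bsub>G\<^esub> k"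
        have l: "?l \<in> carrier G" using g k by simp
        \<comment> \<open>This makes the argument of \<open>r\<close> on the left of
          \<open>ff'\<close> the fixed index \<open>k\<close>, so that \<open>r k\<close> can leave
          the sum.\<close>
        have gl: "g \<otimes>\<^bsub>G\<^esub> ?l = k" using g k by (simp add: G.m_assoc[symmetric])
        have \<psi>l: "inv\<^bsub>G\<^esub> (\<psi> g) \<otimes>\<^bsub>G\<^esub> \<psi> k = \<psi> ?l"
          using g k by (simp add: AutFix_mult[OF \<psi>] \<psi>inv)
        note C = CP_coeff[OF x g] CP_coeff[OF y l] rC[OF g] rC[OF l] rC[OF k]
          cocycles_closed[OF f g l] cocycles_closed[OF f' \<psi>c[OF g] \<psi>c[OF l]]
          act_closed[OF g CP_coeff[OF y l]] act_closed[OF g rC[OF l]]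
        have "?T (\<psi> g) = (x g \<otimes>\<^bsub>R\<^esub> r g) \<otimes>\<^bsub>R\<^esub> (\<eta> g (y ?l) \<otimes>\<^bsub>R\<^esub> \<eta> g (r ?l)) \<otimes>\<^bsub>R\<^esub> f' (\<psi> g, \<psi> ?l)"
          using C by (simp only: \<psi>l \<phi>\<psi>[OF g] \<phi>\<psi>[OF l] AutFix_act[OF \<psi> g] act_mult[OF g])
        also have "\<dots> = x g \<otimes>\<^bsub>R\<^esub> \<eta> g (y ?l) \<otimes>\<^bsub>R\<^esub> (r g \<otimes>\<^bsub>R\<^esub> \<eta> g (r ?l) \<otimes>\<^bsub>R\<^esub> f' (\<psi> g, \<psi> ?l))"
          using C by (simp only: R.m_ac R.m_closed)
        also have "\<dots> = ?S g \<otimes>\<^bsub>R\<^esub> r k"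
          using C by (simp only: ff'[OF g l, symmetric] gl R.m_ac R.m_closed)
        finally show "?T (\<psi> g) = ?S g \<otimes>\<^bsub>R\<^esub> r k" .
      qed simp
      also have "\<dots> = finsum R ?S (carrier G) \<otimes>\<^bsub>R\<^esub> r k"
        by (rule R.finsum_ldistr[OF finite rC[OF k] S, symmetric])
      also have "\<dots> = \<phi> (x \<otimes>\<^bsub>CP f\<^esub> y) (\<psi> k)"
        using k by (simp add: \<phi>\<psi> CP_simps(2))
      finally show "\<phi> (x \<otimes>\<^bsub>CP f\<^esub> y) (\<psi> k) = (\<phi> x \<otimes>\<^bsub>CP f'\<^esub> \<phi> y) (\<psi> k)" ..
    qed (intro \<phi>c CP_mult_closed f f' x y)+
  next
    show "\<phi> \<one>\<^bsub>CP f\<^esub> = \<one>\<^bsub>CP f'\<^esub>"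
    proof (rule eqI)
      have \<psi>1: "\<psi> \<one>\<^bsub>G\<^esub> = \<one>\<^bsub>G\<^esub>"
        using group_hom.hom_one[of G G \<psi>] AutFix_hom[OF \<psi>]
        by (simp add: group_hom_def group_hom_axioms_def G.is_group)
      let ?r = "r \<one>\<^bsub>G\<^esub>" and ?f = "f (\<one>\<^bsub>G\<^esub>, \<one>\<^bsub>G\<^esub>)" and ?f' = "f' (\<one>\<^bsub>G\<^esub>, \<one>\<^bsub>G\<^esub>)"
      have U: "?r \<in> Units R" "?f \<in> Units R" "?f' \<in> Units R"
        using rU cocycles_Units[OF f] cocycles_Units[OF f'] by auto
      note C = U[THEN R.Units_closed] U[THEN R.Units_inv_closed]
      \<comment> \<open>At the identity, where the action is trivial, \<open>ff'\<close> yields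
        \<open>f(e,e) = r_e f'(e,e)\<close>. Hence the identities \<open>f(e,e)^-1 u_e\<close> and
        \<open>f'(e,e)^-1 u_e\<close> correspond.\<close>
      have "?r \<otimes>\<^bsub>R\<^esub> ?f = ?r \<otimes>\<^bsub>R\<^esub> (?r \<otimes>\<^bsub>R\<^esub> ?f')"
        using ff'[of "\<one>\<^bsub>G\<^esub>" "\<one>\<^bsub>G\<^esub>"] C \<psi>1 by (simp add: R.m_ac)
      then have f1: "?f = ?r \<otimes>\<^bsub>R\<^esub> ?f'"
        using R.Units_l_cancel[OF U(1)] C by simp
      have "inv\<^bsub>R\<^esub> ?f \<otimes>\<^bsub>R\<^esub> ?r \<otimes>\<^bsub>R\<^esub> ?f' = inv\<^bsub>R\<^esub> ?f' \<otimes>\<^bsub>R\<^esub> ?f'"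
        using U C by (simp add: f1[symmetric] R.m_assoc)
      then have e: "inv\<^bsub>R\<^esub> ?f \<otimes>\<^bsub>R\<^esub> ?r = inv\<^bsub>R\<^esub> ?f'"
        using U C by (auto intro: Units_right_cancel[OF _ _ U(3)] simp del: R.Units_l_inv R.Units_r_inv)
      fix k assume k: "k \<in> carrier G"
      have "\<psi> k = \<one>\<^bsub>G\<^esub> \<longleftrightarrow> k = \<one>\<^bsub>G\<^esub>"
        using b k \<psi>1 by (metis G.one_closed bij_betw_def inj_onD)
      then show "\<phi> \<one>\<^bsub>CP f\<^esub> (\<psi> k) = \<one>\<^bsub>CP f'\<^esub> (\<psi> k)"
        using k rC[OF k] e by (auto simp: \<phi>\<psi> CP_simps(3) \<psi>c)
    qed (intro \<phi>c CP_one_closed f f')+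
  qed (rule \<phi>c)
  moreover have "\<phi> (a \<odot>\<^bsub>CP f\<^esub> x) = a \<odot>\<^bsub>CP f'\<^esub> \<phi> x" if "a \<in> carrier R" "x \<in> carrier (CP f)" for a x
    using that CP_coeff[OF that(2)] \<theta>c rC
    by (auto simp: \<phi>_def CP_simps(6) fun_eq_iff restrict_def R.m_assoc)
  moreover have "hamming_weight G R (\<phi> x) = hamming_weight G R x" if x: "x \<in> carrier (CP f)" for x
  proof -
    \<comment> \<open>Multiplication by a unit kills no nonzero coefficient even when
      \<open>R\<close> has zero divisors, so the support is only permuted.\<close>
    have "x k \<otimes>\<^bsub>R\<^esub> r k = \<zero>\<^bsub>R\<^esub> \<longleftrightarrow> x k = \<zero>\<^bsub>R\<^esub>" if k: "k \<in> carrier G" for k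
      using Units_right_cancel[OF CP_coeff[OF x k] R.zero_closed rU[OF k]] rC[OF k] by auto
    then have "{k \<in> carrier G. \<phi> x k \<noteq> \<zero>\<^bsub>R\<^esub>} = \<psi> ` {k \<in> carrier G. x k \<noteq> \<zero>\<^bsub>R\<^esub>}"
      using \<psi>c \<theta>c \<psi>\<theta> \<phi>\<psi> by (auto simp: image_iff) (metis \<psi>\<theta> \<theta>c \<phi>\<psi>)
    moreover have "inj_on \<psi> {k \<in> carrier G. x k \<noteq> \<zero>\<^bsub>R\<^esub>}"
      using b by (auto simp: bij_betw_def intro: inj_on_subset)
    ultimately show ?thesis by (simp add: hamming_weight_def card_image)
  qed
  ultimately show ?thesis by (auto simp: isometric_def isometry_def)
qed

section \<open>Orbits and isometry classes\<close>

lemma isometric_iff_orbit: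
  assumes "\<one>\<^bsub>R\<^esub> \<noteq> \<zero>\<^bsub>R\<^esub>" and f: "f \<in> cocycles G R \<eta>" and f': "f' \<in> cocycles G R \<eta>"
  shows "isometric G R (CP f) (CP f') \<longleftrightarrow>
    H2_class G R \<eta> f \<in> orbit (AutFix G \<eta>) (H2_act G R \<eta>) (H2_class G R \<eta> f')"
proof -
  have "H2_class G R \<eta> f \<in> orbit (AutFix G \<eta>) (H2_act G R \<eta>) (H2_class G R \<eta> f') \<longleftrightarrow>
    (\<exists>\<psi> \<in> carrier (AutFix G \<eta>). H2_class G R \<eta> f = H2_class G R \<eta> (twist G \<psi> f'))"
    unfolding orbit_def using H2_act_class[OF _ f'] by (auto intro: exI)
  then show ?thesis
    using isometry_imp_twist[OF assms] isometric_twist[OF f f'] by (auto simp: isometric_def)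
qed

text \<open>Restates \<open>equiv_isometry_rel\<close> in terms of cocycles, the form in which the
  orbit arguments below use it.\<close>

lemma isometric_equiv:
  assumes f: "f1 \<in> cocycles G R \<eta>" "f2 \<in> cocycles G R \<eta>" "f3 \<in> cocycles G R \<eta>"
  shows isometric_refl: "isometric G R (CP f1) (CP f1)"
    and isometric_sym: "isometric G R (CP f1) (CP f2) \<Longrightarrow> isometric G R (CP f2) (CP f1)"
    and isometric_trans: "isometric G R (CP f1) (CP f2) \<Longrightarrow> isometric G R (CP f2) (CP f3) \<Longrightarrow>
      isometric G R (CP f1) (CP f3)"
proof -
  have rel: "(CP a, CP b) \<in> isometry_rel G R \<eta> \<longleftrightarrow> isometric G R (CP a) (CP b)"
    if "a \<in> cocycles G R \<eta>" "b \<in> cocycles G R \<eta>" for a b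
    using that by (auto simp: isometry_rel_def crossed_products_def)
  have mem: "CP f1 \<in> crossed_products G R \<eta>" using f by (simp add: crossed_products_def)
  show "isometric G R (CP f1) (CP f1)"
    using rel[OF f(1,1)] mem equiv_isometry_rel by (auto elim!: equivE dest: refl_onD)
  show "isometric G R (CP f2) (CP f1)" if "isometric G R (CP f1) (CP f2)"
    using that rel[OF f(1,2)] rel[OF f(2,1)] equiv_isometry_rel by (auto elim!: equivE dest: symD)
  show "isometric G R (CP f1) (CP f3)"
    if "isometric G R (CP f1) (CP f2)" "isometric G R (CP f2) (CP f3)"
    using that rel[OF f(1,2)] rel[OF f(2,3)] rel[OF f(1,3)] equiv_isometry_rel
    by (auto elim!: equivE dest: transD)
qed

text \<open>Every orbit is generated by the class of some cocycle \<open>h\<close>, so sharing an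
  orbit means being isometric to a common \<open>CP h\<close>. Symmetry and transitivity of isometry
  then give one direction, and \<open>h = f'\<close> serves for the other.\<close>

lemma isometric_iff_same_orbit:
  assumes one_zero: "\<one>\<^bsub>R\<^esub> \<noteq> \<zero>\<^bsub>R\<^esub>" and f: "f \<in> cocycles G R \<eta>" and f': "f' \<in> cocycles G R \<eta>"
  shows "isometric G R (CP f) (CP f') \<longleftrightarrow>
    (\<exists>\<Omega> \<in> H2_orbits G R \<eta>. H2_class G R \<eta> f \<in> \<Omega> \<and> H2_class G R \<eta> f' \<in> \<Omega>)"
proof -
  have "H2_orbits G R \<eta> =
    (\<lambda>h. orbit (AutFix G \<eta>) (H2_act G R \<eta>) (H2_class G R \<eta> h)) ` cocycles G R \<eta>"
    by (auto simp: H2_orbits_def orbits_def carrier_H2)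
  then have "(\<exists>\<Omega> \<in> H2_orbits G R \<eta>. H2_class G R \<eta> f \<in> \<Omega> \<and> H2_class G R \<eta> f' \<in> \<Omega>) \<longleftrightarrow>
    (\<exists>h \<in> cocycles G R \<eta>. isometric G R (CP f) (CP h) \<and> isometric G R (CP f') (CP h))"
    by (simp add: isometric_iff_orbit[OF one_zero] f f')
  also have "\<dots> \<longleftrightarrow> isometric G R (CP f) (CP f')"
    using isometric_refl[OF f' f' f'] isometric_sym[OF f' _ f'] isometric_trans[OF f _ f'] f'
    by blast
  finally show ?thesis ..
qed

lemma bij_betw_isometry_classes_orbits:
  assumes one_zero: "\<one>\<^bsub>R\<^esub> \<noteq> \<zero>\<^bsub>R\<^esub>"
  shows "\<exists>\<Phi>. bij_betw \<Phi> (crossed_products G R \<eta> // isometry_rel G R \<eta>) (H2_orbits G R \<eta>) \<and>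
    (\<forall>f \<in> cocycles G R \<eta>. \<Phi> (isometry_rel G R \<eta> `` {CP f}) =
       orbit (AutFix G \<eta>) (H2_act G R \<eta>) (H2_class G R \<eta> f))"
proof -
  let ?rel = "isometry_rel G R \<eta>" and ?cls = "H2_class G R \<eta>"
  let ?orb = "\<lambda>f. orbit (AutFix G \<eta>) (H2_act G R \<eta>) (?cls f)"
  \<comment> \<open>Collecting all cocycles whose crossed product lies in \<open>X\<close> avoids a
    choice of representative.\<close>
  define \<Phi> where "\<Phi> X = ?cls ` {f \<in> cocycles G R \<eta>. CP f \<in> X}" for X
  have orb: "?orb f = ?cls ` {f' \<in> cocycles G R \<eta>. isometric G R (CP f') (CP f)}"
    if f: "f \<in> cocycles G R \<eta>" for f
  proof -
    \<comment> \<open>\<open>isometric_iff_orbit\<close> speaks only of classes of cocycles; this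
      inclusion excludes other members of the orbit.\<close>
    have "?orb f \<subseteq> ?cls ` cocycles G R \<eta>"
      using twist_closed[OF _ f] H2_act_class[OF _ f] by (auto simp: orbit_def)
    then show ?thesis using isometric_iff_orbit[OF one_zero _ f] by blast
  qed
  have \<Phi>: "\<Phi> (?rel `` {CP f}) = ?orb f" if f: "f \<in> cocycles G R \<eta>" for f
  proof -
    have "CP f' \<in> ?rel `` {CP f} \<longleftrightarrow> isometric G R (CP f') (CP f)" if "f' \<in> cocycles G R \<eta>" for f'
      using that f isometric_sym[OF f that f] isometric_sym[OF that f f]
      by (auto simp: isometry_rel_def crossed_products_def)
    then show ?thesis unfolding \<Phi>_def orb[OF f] by (metis (mono_tags, lifting))
  qed
  have quot: "crossed_products G R \<eta> // ?rel = (\<lambda>f. ?rel `` {CP f}) ` cocycles G R \<eta>"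
    by (auto simp: quotient_def crossed_products_def)
  have "inj_on \<Phi> (crossed_products G R \<eta> // ?rel)"
  proof (rule inj_onI)
    fix X Y assume "X \<in> crossed_products G R \<eta> // ?rel" "Y \<in> crossed_products G R \<eta> // ?rel"
      and eq: "\<Phi> X = \<Phi> Y"
    then obtain f f' where f: "f \<in> cocycles G R \<eta>" "X = ?rel `` {CP f}"
      and f': "f' \<in> cocycles G R \<eta>" "Y = ?rel `` {CP f'}"
      unfolding quot by blast
    \<comment> \<open>Reflexivity of isometry puts the class into its own orbit, which equals the
      orbit of the class of \<open>f'\<close> by assumption.\<close>
    have "?cls f \<in> ?orb f"
      using isometric_iff_orbit[OF one_zero f(1) f(1)] isometric_refl f(1) by blast
    then have "isometric G R (CP f) (CP f')"
      using eq \<Phi> f f' isometric_iff_orbit[OF one_zero] by simp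
    then show "X = Y"
      using equiv_class_eq[OF equiv_isometry_rel, of "CP f" "CP f'"] f f'
      by (auto simp: isometry_rel_def crossed_products_def)
  qed
  moreover have "\<Phi> ` (crossed_products G R \<eta> // ?rel) = H2_orbits G R \<eta>"
    unfolding quot image_image by (auto simp: \<Phi> H2_orbits_def orbits_def carrier_H2)
  ultimately show ?thesis using \<Phi> by (auto simp: bij_betw_def intro!: exI[of _ \<Phi>])
qed

end

theorem corollary2p4:
  fixes G :: "('g, 'm) monoid_scheme" and R :: "('r, 'n) ring_scheme"
    and \<eta> :: "'g \<Rightarrow> 'r \<Rightarrow> 'r"
  assumes "group G" and "finite (carrier G)"
    and "cring R" and "\<one>\<^bsub>R\<^esub> \<noteq> \<zero>\<^bsub>R\<^esub>"
    and "\<eta> \<in> hom G (RingAut R)"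
  shows "(\<forall>f \<in> carrier (Z2 G R \<eta>). \<forall>f' \<in> carrier (Z2 G R \<eta>).
            isometric G R (crossed_product G R \<eta> f) (crossed_product G R \<eta> f') \<longleftrightarrow>
            (\<exists>\<Omega> \<in> H2_orbits G R \<eta>. H2_class G R \<eta> f \<in> \<Omega> \<and> H2_class G R \<eta> f' \<in> \<Omega>))
       \<and> (\<exists>\<Phi>. bij_betw \<Phi> (crossed_products G R \<eta> // isometry_rel G R \<eta>) (H2_orbits G R \<eta>)
            \<and> (\<forall>f \<in> carrier (Z2 G R \<eta>).
                 \<Phi> (isometry_rel G R \<eta> `` {crossed_product G R \<eta> f}) =
                 orbit (AutFix G \<eta>) (H2_act G R \<eta>) (H2_class G R \<eta> f)))"
proof -
  interpret finite_ring_action G R \<eta>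
    using assms by (simp add: finite_ring_action_def finite_ring_action_axioms_def
        ring_action_def ring_action_axioms_def)
  show ?thesis
    unfolding Z2_simps(1)
    using isometric_iff_same_orbit[OF assms(4)] bij_betw_isometry_classes_orbits[OF assms(4)]
    by blast
qed

end
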